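(* Let $N\ge 3$. (i) For all integers $0<a_1<a_2<\cdots<a_N$ with $\gcd(a_1,\ldots,a_N)=1$, $$\mu_0(S_{N-1})\le \frac{f_N(a_1,\ldots,a_N)}{(a_1\cdots a_N)^{1/(N-1)}}.$$ (ii) For every $\epsilon>0$ and every point $\alpha=(\alpha_1,\ldots,\alpha_{N-1})\in\mathbb{R}^{N-1}$ there exist integers $0<a_1<a_2<\cdots<a_N$ with $\gcd(a_1,\ldots,a_N)=1$ such that $$\left|\alpha_i-\frac{a_i}{a_N}\right|<\epsilon,\quad i=1,\ldots,N-1,$$ and $$\frac{f_N(a_1,\ldots,a_N)}{(a_1\cdots a_N)^{1/(N-1)}}<\mu_0(S_{N-1})+\epsilon.$$
   Context: For positive integers $a_1,\ldots,a_N$ with $\gcd(a_1,\ldots,a_N)=1$, $f_N(a_1,\ldots,a_N)$ denotes the largest integer which is not a positive integer combination $\sum_i x_i a_i$ with all $x_i\ge 1$ integers (equivalently, $f_N=g_N+\sum_i a_i$, where the Frobenius number $g_N$ is the largest integer not representable as a non-negative integer combination of $a_1,\ldots,a_N$). A lattice $L\subset\mathbb{R}^{N-1}$ is a covering lattice for a set $S\subset\mathbb{R}^{N-1}$ if $\bigcup_{l\in L}(S+l)=\mathbb{R}^{N-1}$. The inhomogeneous minimum of $S$ with respect to $L$ is $\mu(S,L)=\inf\{\sigma>0: L \text{ is a covering lattice of } \sigma S\}$, and the absolute inhomogeneous minimum is $\mu_0(S)=\inf\{\mu(S,L): L \text{ a lattice with } \det L=1\}$. $S_{N-1}=\{(x_1,\ldots,x_{N-1})\in\mathbb{R}^{N-1}: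 x_i\ge 0,\ \sum_{i=1}^{N-1}x_i\le 1\}$ is the standard simplex.
   Formalization: Part (ii) is proved for points with 0 ≤ α_1 ≤ … ≤ α_{N-1} ≤ 1 rather than every α in R^{N-1}: since 0 < a_1 < … < a_N forces increasing ratios in (0,1), other points, e.g. (5,…,5), cannot be approximated for small ε. *)

theory Defs
  imports "HOL-Analysis.Analysis"
begin

text \<open>\<open>GREATEST\<close> is meaningful since for relatively prime \<open>a i > 0\<close> the set of
  integers without such a representation is bounded above.\<close>

definition f_pos :: "nat \<Rightarrow> (nat \<Rightarrow> int) \<Rightarrow> int" where
  "f_pos N a = (GREATEST m. \<not> (\<exists>x :: nat \<Rightarrow> int. (\<forall>i\<in>{1..N}. 1 \<le> x i) \<and> m = (\<Sum>i=1..N. x i * a i)))"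

definition admissible :: "nat \<Rightarrow> (nat \<Rightarrow> int) \<Rightarrow> bool" where
  "admissible N a \<longleftrightarrow> 0 < a 1 \<and> strict_mono_on {1..N} a \<and> Gcd (a ` {1..N}) = 1"

definition lattice_of :: "real ^ 'n ^ 'n \<Rightarrow> (real ^ 'n) set" where
  "lattice_of B = {B *v z | z. \<forall>i. z $ i \<in> \<int>}"

definition is_lattice :: "(real ^ 'n) set \<Rightarrow> bool" where
  "is_lattice L \<longleftrightarrow> (\<exists>B. invertible B \<and> L = lattice_of B)"

definition lattice_det :: "(real ^ 'n) set \<Rightarrow> real" where
  "lattice_det L = (THE d. \<exists>B. invertible B \<and> L = lattice_of B \<and> d = \<bar>det B\<bar>)"

definition covering_lattice :: "(real ^ 'n) set \<Rightarrow> (real ^ 'n) set \<Rightarrow> bool" where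
  "covering_lattice S L \<longleftrightarrow> is_lattice L \<and> (\<Union>l\<in>L. (\<lambda>s. s + l) ` S) = UNIV"

text \<open>These infima are the intended ones when the sets are nonempty, which is the case for
  every lattice if \<open>S\<close> has nonempty interior.\<close>

definition inhom_min :: "(real ^ 'n) set \<Rightarrow> (real ^ 'n) set \<Rightarrow> real" where
  "inhom_min S L = Inf {\<sigma>. 0 < \<sigma> \<and> covering_lattice ((\<lambda>s. \<sigma> *\<^sub>R s) ` S) L}"

definition abs_inhom_min :: "(real ^ 'n) set \<Rightarrow> real" where
  "abs_inhom_min S = Inf {inhom_min S L | L. is_lattice L \<and> lattice_det L = 1}"

definition std_simplex :: "(real ^ 'n) set" where
  "std_simplex = {x. (\<forall>i. 0 \<le> x $ i) \<and> (\<Sum>i\<in>UNIV. x $ i) \<le> 1}"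

lemma lattice_of_subset_det:
  fixes B C :: "real ^ 'n ^ 'n"
  assumes "lattice_of B \<subseteq> lattice_of C"
  shows "\<exists>k\<in>\<int>. det B = det C * k"
proof -
  have "\<exists>z. (\<forall>i. z $ i \<in> \<int>) \<and> column j B = C *v z" for j
  proof -
    have "column j B = B *v axis j 1"
      by (simp add: matrix_vector_mult_basis)
    moreover have "\<forall>i. (axis j 1 :: real ^ 'n) $ i \<in> \<int>"
      by (simp add: axis_def)
    ultimately have "column j B \<in> lattice_of B"
      unfolding lattice_of_def by blast
    with assms have "column j B \<in> lattice_of C" by blast
    then show ?thesis unfolding lattice_of_def by auto
  qed
  then obtain z where z: "\<And>j i. z j $ i \<in> \<int>" "\<And>j. column j B = C *v z j"
    by metis
  define U :: "real ^ 'n ^ 'n" where "U = (\<chi> i j. z j $ i)"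
  have "B $ i $ j = (C ** U) $ i $ j" for i j
  proof -
    have "B $ i $ j = column j B $ i" by (simp add: column_def)
    also have "\<dots> = (C *v z j) $ i" by (simp add: z)
    finally show ?thesis
      by (simp add: U_def matrix_matrix_mult_def matrix_vector_mult_def)
  qed
  then have "B = C ** U" by (simp add: vec_eq_iff)
  then have "det B = det C * det U" by (simp add: det_mul)
  moreover have "det U \<in> \<int>"
    unfolding det_def using z(1)
    by (intro Ints_sum Ints_mult Ints_prod) (auto simp: U_def)
  ultimately show ?thesis by blast
qed

lemma lattice_det_lattice_of:
  fixes B :: "real ^ 'n ^ 'n"
  assumes "invertible B"
  shows "lattice_det (lattice_of B) = \<bar>det B\<bar>"
  unfolding lattice_det_def
proof (rule the_equality)
  show "\<exists>B'. invertible B' \<and> lattice_of B = lattice_of B' \<and> \<bar>det B\<bar> = \<bar>det B'\<bar>"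
    using assms by blast
next
  have le: "\<bar>det Y\<bar> \<le> \<bar>det X\<bar>"
    if inv: "invertible X" and sub: "lattice_of X \<subseteq> lattice_of Y" for X Y :: "real ^ 'n ^ 'n"
  proof -
    obtain k where k: "k \<in> \<int>" "det X = det Y * k"
      using lattice_of_subset_det[OF sub] by blast
    have "det X \<noteq> 0" using inv by (simp add: invertible_det_nz)
    with k have "1 \<le> \<bar>k\<bar>" by (intro Ints_nonzero_abs_ge1) auto
    then show ?thesis using k(2)
      by (simp add: abs_mult mult_le_cancel_left1)
  qed
  fix d assume "\<exists>B'. invertible B' \<and> lattice_of B = lattice_of B' \<and> d = \<bar>det B'\<bar>"
  then show "d = \<bar>det B\<bar>" 
    using le assms by (elim exE conjE) (simp add: order_antisym)
qed

text \<open>The ratios \<open>a i / a N\<close> of an admissible tuple lie in \<open>(0,1)\<close> and increase, so only the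
  points \<open>0 \<le> \<alpha> 1 \<le> \<dots> \<le> \<alpha> (N-1) \<le> 1\<close> can be approximated by them.\<close>

definition ratio_point :: "nat \<Rightarrow> (nat \<Rightarrow> real) \<Rightarrow> bool" where
  "ratio_point N \<alpha> \<longleftrightarrow> (\<forall>i\<in>{1..N-1}. 0 \<le> \<alpha> i \<and> \<alpha> i \<le> 1) \<and> mono_on {1..N-1} \<alpha>"

lemma ratio_point_necessary:
  assumes approx: "\<And>\<epsilon>. 0 < \<epsilon> \<Longrightarrow>
    \<exists>a. admissible N a \<and> (\<forall>i\<in>{1..N-1}. \<bar>\<alpha> i - real_of_int (a i) / real_of_int (a N)\<bar> < \<epsilon>)"
  shows "ratio_point N \<alpha>"
proof -
  have main: "- \<epsilon> \<le> \<alpha> i \<and> \<alpha> j \<le> 1 + \<epsilon> \<and> \<alpha> i \<le> \<alpha> j + 2 * \<epsilon>"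
    if ij: "i \<in> {1..N-1}" "j \<in> {1..N-1}" "i \<le> j" and "0 < \<epsilon>" for i j \<epsilon>
  proof -
    obtain a where a: "admissible N a"
      and ap: "\<And>i. i \<in> {1..N-1} \<Longrightarrow> \<bar>\<alpha> i - real_of_int (a i) / real_of_int (a N)\<bar> < \<epsilon>"
      using approx[OF \<open>0 < \<epsilon>\<close>] by blast
    have sm: "a k \<le> a l" if "k \<in> {1..N}" "l \<in> {1..N}" "k \<le> l" for k l
      using a that strict_mono_onD[of "{1..N}" a k l] unfolding admissible_def
      by (cases "k = l") auto
    have "0 < a 1" using a unfolding admissible_def by blast
    moreover have "i \<in> {1..N}" "j \<in> {1..N}" "1 \<in> {1..N}" "N \<in> {1..N}" "j \<le> N" "1 \<le> i"
      using ij by auto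
    ultimately have "0 < a i" "a i \<le> a j" "a j \<le> a N"
      using sm[of 1 i] sm[of i j] sm[of j N] ij(3) by linarith+
    then have "0 \<le> real_of_int (a i) / real_of_int (a N)"
      "real_of_int (a i) / real_of_int (a N) \<le> real_of_int (a j) / real_of_int (a N)"
      "real_of_int (a j) / real_of_int (a N) \<le> 1"
      by (auto simp: divide_right_mono)
    then show ?thesis using ap[OF ij(1)] ap[OF ij(2)] by linarith
  qed
  have lim: "x \<le> y" if h: "\<And>\<epsilon>. 0 < \<epsilon> \<Longrightarrow> x \<le> y + 2 * \<epsilon>" for x y :: real
  proof (rule field_le_epsilon)
    fix e :: real assume "0 < e"
    then show "x \<le> y + e" using h[of "e / 2"] by simp
  qed
  have "0 \<le> \<alpha> i \<and> \<alpha> i \<le> 1" if i: "i \<in> {1..N-1}" for i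
  proof
    show "0 \<le> \<alpha> i"
    proof (rule lim)
      fix \<epsilon> :: real assume "0 < \<epsilon>"
      with main[OF i i order_refl this] show "0 \<le> \<alpha> i + 2 * \<epsilon>" by linarith
    qed
    show "\<alpha> i \<le> 1"
    proof (rule lim)
      fix \<epsilon> :: real assume "0 < \<epsilon>"
      with main[OF i i order_refl this] show "\<alpha> i \<le> 1 + 2 * \<epsilon>" by linarith
    qed
  qed
  moreover have "\<alpha> i \<le> \<alpha> j" if ij: "i \<in> {1..N-1}" "j \<in> {1..N-1}" "i \<le> j" for i j
  proof (rule lim)
    fix \<epsilon> :: real assume "0 < \<epsilon>"
    with main[OF ij this] show "\<alpha> i \<le> \<alpha> j + 2 * \<epsilon>" by linarith
  qed
  ultimately show ?thesis unfolding ratio_point_def by (auto intro: mono_onI)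
qed

end

theory Submission
  imports Defs "HOL-Number_Theory.Cong"
begin

text \<open>
  Put \<open>n = N - 1\<close>, \<open>w = (a\<^sub>1, \<dots>, a\<^sub>n)\<close>, \<open>d = a\<^sub>N\<close>, and let \<open>L\<close> be the lattice of integer
  vectors \<open>z\<close> with \<open>w \<bullet> z \<equiv> 0 (mod d)\<close>. Comparing residues modulo \<open>d\<close> shows that \<open>f\<^sub>N\<close> is the
  least \<open>\<sigma>\<close> for which \<open>L\<close> covers with \<open>\<sigma> \<cdot> {x \<ge> 0. w \<bullet> x \<le> 1}\<close> (Kannan). Since \<open>det L = d\<close>,
  rescaling the coordinates by \<open>w\<close> and normalising the determinant gives (i).

  For (ii), take a nearly optimal lattice \<open>B\<^sub>0 \<int>\<^sup>n\<close> of determinant \<open>\<plusminus>1\<close>, perturb \<open>\<alpha>\<close> to be strictly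
  increasing in \<open>(0,1)\<close>, and put \<open>A = diag(1/\<alpha>) B\<^sub>0\<close>. An integer matrix \<open>E\<close> with an extra integer
  row \<open>c\<close>, close to a multiple of \<open>A\<close> with extra row \<open>- \<alpha> A\<close>, has maximal minors proportional to
  a tuple \<open>a\<close> with \<open>a\<^sub>i / a\<^sub>N\<close> close to \<open>\<alpha>\<^sub>i\<close>, and its columns lie in the lattice \<open>L\<close> of that tuple.
  It remains to make the minors coprime. If \<open>E = 1 + t B\<close> and \<open>c = t c\<^sub>0\<close>, a prime dividing all
  minors yields a kernel vector modulo \<open>p\<close>, an eigenvector of \<open>B\<close> annihilated by \<open>c\<^sub>0\<close>, hence by all
  \<open>c\<^sub>0 B\<^sup>k\<close>; so \<open>p\<close> divides the determinant of the matrix with rows \<open>c\<^sub>0 B\<^sup>k\<close>, \<open>k < n\<close>. Taking \<open>t\<close> to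
  be this determinant excludes every \<open>p\<close>, and it is nonzero, in fact odd, if \<open>B\<close> is a shift
  matrix and \<open>c\<^sub>0\<close> a unit vector modulo \<open>2\<close>.
\<close>

section \<open>Integer matrices modulo a prime\<close>

text \<open>If \<open>c\<close> is appended to \<open>M\<close> as an extra row, these determinants
  are, up to sign, the maximal minors that omit a row of \<open>M\<close>; the remaining maximal
  minor is \<open>det M\<close>.\<close>

definition replace_row :: "'a ^ 'n ^ 'n \<Rightarrow> 'n \<Rightarrow> 'a ^ 'n \<Rightarrow> 'a ^ 'n ^ 'n" where
  "replace_row M k c = (\<chi> i j. if i = k then c $ j else M $ i $ j)"

definition real_vec :: "int ^ 'n \<Rightarrow> real ^ 'n" where
  "real_vec v = (\<chi> i. of_int (v $ i))"

definition real_mat :: "int ^ 'n ^ 'n \<Rightarrow> real ^ 'n ^ 'n" where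
  "real_mat M = (\<chi> i j. of_int (M $ i $ j))"

lemma det_real_mat: "det (real_mat M) = of_int (det M)"
  by (simp add: det_def real_mat_def)

lemma real_mat_vector_mult: "real_mat M *v real_vec v = real_vec (M *v v)"
  by (simp add: real_mat_def real_vec_def matrix_vector_mult_def vec_eq_iff)

lemma real_mat_replace_row: "real_mat (replace_row M k c) = replace_row (real_mat M) k (real_vec c)"
  by (simp add: real_mat_def real_vec_def replace_row_def vec_eq_iff)

lemma det_cong_mod:
  fixes A B :: "int ^ 'n ^ 'n"
  assumes "\<And>i j. [A $ i $ j = B $ i $ j] (mod p)"
  shows "[det A = det B] (mod p)"
  unfolding det_def
  by (intro cong_sum cong_mult cong_refl cong_prod assms)

text \<open>Pigeonhole on residue vectors: if multiplication by \<open>M\<close> were injective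
  modulo \<open>p\<close>, it would be surjective, the preimages of the unit vectors would form a
  right inverse modulo \<open>p\<close>, and \<open>det M\<close> would be a unit modulo
  \<open>p\<close>.\<close>

lemma dvd_det_imp_kernel_mod:
  fixes M :: "int ^ 'n ^ 'n"
  assumes p: "1 < p" and "p dvd det M"
  obtains v where "\<exists>i. \<not> p dvd v $ i" and "\<And>i. p dvd (M *v v) $ i"
proof -
  define V where "V = {v :: int ^ 'n. \<forall>i. 0 \<le> v $ i \<and> v $ i < p}"
  define F where "F = (\<lambda>v. (\<chi> i. (M *v v) $ i mod p) :: int ^ 'n)"
  have "V \<subseteq> vec_lambda ` (UNIV \<rightarrow>\<^sub>E {0..<p})"
  proof
    fix v assume "v \<in> V"
    then have "v = vec_lambda (($) v)" "($) v \<in> UNIV \<rightarrow>\<^sub>E {0..<p}"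
      by (auto simp: V_def)
    then show "v \<in> vec_lambda ` (UNIV \<rightarrow>\<^sub>E {0..<p})" by blast
  qed
  moreover have "finite (vec_lambda ` ((UNIV :: 'n set) \<rightarrow>\<^sub>E {0..<p}))"
    by (intro finite_imageI finite_PiE) auto
  ultimately have "finite V" by (rule finite_subset)
  have FV: "F ` V \<subseteq> V" using p by (auto simp: F_def V_def)
  have "\<not> inj_on F V"
  proof
    assume "inj_on F V"
    with \<open>finite V\<close> FV have surj: "F ` V = V" by (rule endo_inj_surj)
    have "\<exists>v. F v = axis j 1" for j
    proof -
      have "axis j 1 \<in> V" using p by (auto simp: V_def axis_def)
      with surj show ?thesis by (metis imageE)
    qed
    then obtain u where u: "\<And>j. F (u j) = axis j 1" by metis
    define U :: "int ^ 'n ^ 'n" where "U = (\<chi> i j. u j $ i)"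
    have "[(M ** U) $ i $ j = mat 1 $ i $ j] (mod p)" for i j
    proof -
      have "(M ** U) $ i $ j = (M *v u j) $ i"
        by (simp add: U_def matrix_matrix_mult_def matrix_vector_mult_def)
      moreover have "(M *v u j) $ i mod p = (mat 1 :: int ^ 'n ^ 'n) $ i $ j"
        using arg_cong[OF u[of j], of "\<lambda>x. x $ i"] by (simp add: F_def axis_def mat_def)
      ultimately show ?thesis unfolding cong_def using p by (metis mod_mod_trivial)
    qed
    then have "[det (M ** U) = 1] (mod p)" using det_cong_mod by (metis det_I)
    moreover have "p dvd det (M ** U)" using assms(2) by (simp add: det_mul)
    ultimately have "p dvd 1" by (metis cong_dvd_iff)
    with p show False by auto
  qed
  then obtain x y where xy: "x \<in> V" "y \<in> V" "x \<noteq> y" "F x = F y" by (auto simp: inj_on_def)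
  show thesis
  proof
    \<comment> \<open>Both vectors have entries in \<open>{0..<p}\<close>, so entries that differ
      are incongruent modulo \<open>p\<close>.\<close>
    obtain i where "x $ i \<noteq> y $ i" using xy(3) by (auto simp: vec_eq_iff)
    moreover have "0 \<le> x $ i" "x $ i < p" "0 \<le> y $ i" "y $ i < p"
      using xy(1,2) by (auto simp: V_def)
    then have "\<bar>x $ i - y $ i\<bar> < \<bar>p\<bar>" by linarith
    ultimately have "\<not> p dvd (x - y) $ i" using dvd_imp_le_int[of "x $ i - y $ i" p] by auto
    then show "\<exists>i. \<not> p dvd (x - y) $ i" by blast
    show "p dvd (M *v (x - y)) $ i" for i
      using arg_cong[OF xy(4), of "\<lambda>x. x $ i"]
      by (simp add: F_def matrix_vector_mult_diff_distrib mod_eq_dvd_iff)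
  qed
qed

text \<open>Cramer's rule: replacing column \<open>k\<close> of \<open>M\<close> by
  \<open>M *v v\<close> multiplies the determinant by \<open>v $ k\<close>, and the new column
  vanishes modulo \<open>p\<close>. This serves for primes and later for the modulus
  \<open>d\<close>.\<close>

lemma kernel_mod_imp_dvd_det:
  fixes M :: "int ^ 'n ^ 'n"
  assumes "\<And>i. p dvd (M *v v) $ i"
  shows "p dvd v $ k * det M"
proof -
  define A :: "int ^ 'n ^ 'n" where "A = (\<chi> i j. if j = k then (M *v v) $ i else M $ i $ j)"
  have "real_mat A = (\<chi> i j. if j = k then (real_mat M *v real_vec v) $ i else real_mat M $ i $ j)"
    unfolding real_mat_vector_mult by (simp add: A_def real_mat_def real_vec_def vec_eq_iff)
  then have "det (real_mat A) = real_vec v $ k * det (real_mat M)"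
    by (simp only: cramer_lemma)
  then have "det A = v $ k * det M"
    unfolding det_real_mat real_vec_def by (simp flip: of_int_mult)
  moreover have "[det A = det (\<chi> i j. if j = k then 0 else M $ i $ j)] (mod p)"
    by (rule det_cong_mod) (use assms in \<open>simp add: A_def cong_0_iff\<close>)
  moreover have "det (\<chi> i j. if j = k then 0 else M $ i $ j) = 0"
    by (rule det_zero_column(1)[of k]) (simp add: column_def vec_eq_iff)
  ultimately show ?thesis by (simp add: cong_0_iff)
qed

text \<open>Take \<open>y\<close> annihilating \<open>E\<close> from the left modulo
  \<open>p\<close> with \<open>y $ k\<close> nonzero, and \<open>v\<close> in the kernel of
  \<open>E\<close> with row \<open>k\<close> replaced by \<open>c\<close>. Then
  \<open>E *v v\<close> can be nonzero only at \<open>k\<close>, and pairing it with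
  \<open>y\<close> removes that entry too.\<close>

lemma dvd_minors_imp_kernel_mod:
  fixes E :: "int ^ 'n ^ 'n"
  assumes p: "prime p" and "p dvd det E" and "\<And>i. p dvd det (replace_row E i c)"
  obtains v where "\<exists>i. \<not> p dvd v $ i" and "\<And>i. p dvd (E *v v) $ i"
    and "p dvd (\<Sum>j\<in>UNIV. c $ j * v $ j)"
proof -
  have p1: "1 < p" using p by (rule prime_gt_1_int)
  obtain y k where y: "\<And>j. p dvd (transpose E *v y) $ j" and k: "\<not> p dvd y $ k"
    using dvd_det_imp_kernel_mod[OF p1, of "transpose E"] assms(2) by (metis det_transpose)
  obtain v where v: "\<exists>i. \<not> p dvd v $ i" "\<And>i. p dvd (replace_row E k c *v v) $ i"
    using dvd_det_imp_kernel_mod[OF p1 assms(3)] by metis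
  have ne: "p dvd (E *v v) $ i" if "i \<noteq> k" for i
    using v(2)[of i] that by (simp add: replace_row_def matrix_vector_mult_def)
  have "(\<Sum>i\<in>UNIV. y $ i * (E *v v) $ i) = (\<Sum>j\<in>UNIV. (transpose E *v y) $ j * v $ j)"
    unfolding matrix_vector_mult_def transpose_def
    by (simp add: sum_distrib_left sum_distrib_right mult_ac) (rule sum.swap)
  also have "p dvd \<dots>" using y by (intro dvd_sum) simp
  finally have "p dvd (\<Sum>i\<in>UNIV. y $ i * (E *v v) $ i)" .
  moreover have "(\<Sum>i\<in>UNIV. y $ i * (E *v v) $ i)
      = y $ k * (E *v v) $ k + (\<Sum>i\<in>UNIV - {k}. y $ i * (E *v v) $ i)"
    by (simp add: sum.remove)
  moreover have "p dvd (\<Sum>i\<in>UNIV - {k}. y $ i * (E *v v) $ i)"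
    using ne by (intro dvd_sum) simp
  ultimately have "p dvd y $ k * (E *v v) $ k" by (simp add: dvd_add_left_iff)
  with k p have "p dvd (E *v v) $ k" by (simp add: prime_dvd_mult_iff)
  with ne have "\<And>i. p dvd (E *v v) $ i" by metis
  moreover have "p dvd (\<Sum>j\<in>UNIV. c $ j * v $ j)"
    using v(2)[of k] by (simp add: replace_row_def matrix_vector_mult_def)
  ultimately show thesis using that v(1) by blast
qed

text \<open>The accuracy is prescribed through \<open>s\<close>, while the scale
  \<open>\<tau>\<close> is an output: it involves a determinant known only after rounding at scale
  \<open>s\<close>. The last condition says that the maximal minors are coprime.\<close>

lemma primitive_approximation:
  fixes A :: "real ^ 'n ^ 'n" and g :: "real ^ 'n" and s :: real
  assumes s: "0 < s"
  obtains E :: "int ^ 'n ^ 'n" and c :: "int ^ 'n" and \<tau> :: real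
  where "0 < \<tau>"
    and "\<And>i j. \<bar>of_int (E $ i $ j) / \<tau> - A $ i $ j\<bar> \<le> 2 / s"
    and "\<And>j. \<bar>of_int (c $ j) / \<tau> - g $ j\<bar> \<le> 2 / s"
    and "\<And>p. prime p \<Longrightarrow> p dvd det E \<Longrightarrow> \<exists>i. \<not> p dvd det (replace_row E i c)"
proof -
  obtain b :: "'n \<Rightarrow> nat" where b: "bij_betw b UNIV {..<CARD('n)}"
    using ex_bij_betw_finite_nat[of "UNIV :: 'n set"] by (auto simp: atLeast0LessThan)
  \<comment> \<open>The even part rounds \<open>2 * s * A\<close>. The indicator makes
    \<open>B\<close> modulo 2 the shift that carries each unit row vector to the next one in the
    enumeration \<open>b\<close>, and the last one to 0.\<close>
  define B :: "int ^ 'n ^ 'n"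
    where "B = (\<chi> i j. 2 * \<lfloor>s * A $ i $ j\<rfloor> + (if b j = Suc (b i) then 1 else 0))"
  define c0 :: "int ^ 'n" where "c0 = (\<chi> j. 2 * \<lfloor>s * g $ j\<rfloor> + (if b j = 0 then 1 else 0))"
  define r :: "nat \<Rightarrow> int ^ 'n" where "r k = ((\<lambda>x. x v* B) ^^ k) c0" for k
  have r_Suc: "r (Suc k) = r k v* B" for k by (simp add: r_def)
  have r_mod: "[r k $ j = (if b j = k then 1 else 0)] (mod 2)" if "k < CARD('n)" for k j
    using that
  proof (induction k arbitrary: j)
    case 0
    show ?case by (simp add: r_def c0_def cong_iff_dvd_diff)
  next
    case (Suc k)
    then obtain i where i: "b i = k" using b by (metis Suc_lessD bij_betw_iff_bijections lessThan_iff)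
    have bi: "b i' = k \<longleftrightarrow> i' = i" for i' using b i by (metis bij_betw_def injD)
    have "r (Suc k) $ j = (\<Sum>i'\<in>UNIV. B $ i' $ j * r k $ i')"
      by (simp add: r_Suc vector_matrix_mult_def mult.commute)
    also have "[\<dots> = (\<Sum>i'\<in>UNIV. (if b j = Suc (b i') then 1 else 0) * (if b i' = k then 1 else 0))] (mod 2)"
      using Suc by (intro cong_sum cong_mult) (auto simp: B_def cong_iff_dvd_diff)
    also have "(\<Sum>i'\<in>UNIV. (if b j = Suc (b i') then 1 else 0) * (if b i' = k then 1 else 0))
        = (if b j = Suc k then 1 else 0 :: int)"
    proof -
      have "(if b j = Suc (b i') then 1 else 0) * (if b i' = k then 1 else 0)
          = (if i' = i then if b j = Suc k then 1 else 0 else 0 :: int)" for i'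
        by (simp add: bi i)
      then show ?thesis by simp
    qed
    finally show ?case .
  qed
  \<comment> \<open>This is the observability matrix of the pair \<open>(c0, B)\<close>. It is the
    identity modulo 2, so its determinant is odd.\<close>
  define Ob :: "int ^ 'n ^ 'n" where "Ob = (\<chi> i. r (b i))"
  have "[det Ob = det (mat 1 :: int ^ 'n ^ 'n)] (mod 2)"
  proof (rule det_cong_mod)
    fix i j
    have "b i < CARD('n)" using b by (auto simp: bij_betw_def)
    moreover have "b j = b i \<longleftrightarrow> i = j" using b by (metis bij_betw_def injD)
    ultimately show "[Ob $ i $ j = mat 1 $ i $ j] (mod 2)"
      using r_mod[of "b i" j] by (simp add: Ob_def mat_def)
  qed
  then have "det Ob \<noteq> 0" by (auto simp: cong_def)
  define t where "t = \<bar>det Ob\<bar>"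
  have t: "1 \<le> t" using \<open>det Ob \<noteq> 0\<close> by (simp add: t_def)
  define E :: "int ^ 'n ^ 'n" where "E = (\<chi> i j. (if i = j then 1 else 0) + t * B $ i $ j)"
  define c :: "int ^ 'n" where "c = (\<chi> j. t * c0 $ j)"
  define \<tau> where "\<tau> = 2 * real_of_int t * s"
  \<comment> \<open>Here \<open>e\<close> is an entry of the identity matrix and \<open>e'\<close> a
    parity indicator. After division by \<open>2 * t * s\<close>, these corrections and the rounding
    error contribute at most \<open>4 / (2 * s)\<close>.\<close>
  have fl: "\<bar>(e + t * (2 * \<lfloor>s * x\<rfloor> + e')) / \<tau> - x\<bar> \<le> 2 / s"
    if "0 \<le> e" "e \<le> 1" "0 \<le> e'" "e' \<le> 1" for e e' x :: real
  proof -
    define \<theta> where "\<theta> = s * x - \<lfloor>s * x\<rfloor>"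
    have th: "0 \<le> \<theta>" "\<theta> \<le> 1" unfolding \<theta>_def by linarith+
    have "(e + t * (2 * \<lfloor>s * x\<rfloor> + e')) / \<tau> - x = (e / t + e' - 2 * \<theta>) / (2 * s)"
      unfolding \<tau>_def \<theta>_def using s t by (simp add: field_simps)
    moreover have "0 \<le> e / t" "e / t \<le> 1" using that t by (auto simp: field_simps)
    then have "\<bar>e / t + e' - 2 * \<theta>\<bar> \<le> 4" using that th by linarith
    then have "\<bar>(e / t + e' - 2 * \<theta>) / (2 * s)\<bar> \<le> 2 / s"
      using s by (simp add: abs_divide field_simps)
    ultimately show ?thesis by metis
  qed
  have Ev: "(E *v v) $ i = v $ i + t * (B *v v) $ i" for v i
  proof -
    have "E $ i $ j * v $ j = (if i = j then v $ j else 0) + t * (B $ i $ j * v $ j)" for j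
      by (simp add: E_def algebra_simps)
    then show ?thesis by (simp add: matrix_vector_mult_def sum.distrib sum_distrib_left)
  qed
  show thesis
  proof
    show "0 < \<tau>" using s t by (simp add: \<tau>_def)
    show "\<bar>of_int (E $ i $ j) / \<tau> - A $ i $ j\<bar> \<le> 2 / s" for i j
      using fl[of "if i = j then 1 else 0" "if b j = Suc (b i) then 1 else 0" "A $ i $ j"]
      by (auto simp: E_def B_def)
    show "\<bar>of_int (c $ j) / \<tau> - g $ j\<bar> \<le> 2 / s" for j
      using fl[of 0 "if b j = 0 then 1 else 0" "g $ j"]
      by (auto simp: c_def c0_def)
    show "\<exists>i. \<not> p dvd det (replace_row E i c)" if p: "prime p" "p dvd det E" for p
    proof (rule ccontr)
      assume "\<nexists>i. \<not> p dvd det (replace_row E i c)"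
      then obtain v k where k: "\<not> p dvd v $ k" and v: "\<And>i. p dvd (E *v v) $ i"
        and cv: "p dvd (\<Sum>j\<in>UNIV. c $ j * v $ j)"
        using dvd_minors_imp_kernel_mod[OF p] by metis
      \<comment> \<open>If \<open>p\<close> divided \<open>t\<close>, then \<open>E\<close> would be
        the identity modulo \<open>p\<close> and \<open>v\<close> would vanish modulo
        \<open>p\<close>.\<close>
      have "\<not> p dvd t" using k v[of k] by (auto simp: Ev dvd_add_left_iff)
      \<comment> \<open>Modulo \<open>p\<close>, \<open>t\<close> times \<open>B *v v\<close> is
        \<open>- v\<close>, so divisibility passes from \<open>r m\<close> to
        \<open>r (Suc m)\<close> up to a factor \<open>t\<close>, which cancels.\<close>
      have "p dvd (\<Sum>j\<in>UNIV. r m $ j * v $ j)" for m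
      proof (induction m)
        case 0
        have "(\<Sum>j\<in>UNIV. c $ j * v $ j) = t * (\<Sum>j\<in>UNIV. r 0 $ j * v $ j)"
          by (simp add: c_def r_def sum_distrib_left mult.assoc)
        with cv p \<open>\<not> p dvd t\<close> show ?case by (simp add: prime_dvd_mult_iff)
      next
        case (Suc m)
        have "(\<Sum>j\<in>UNIV. r (Suc m) $ j * v $ j) = (\<Sum>i\<in>UNIV. r m $ i * (B *v v) $ i)"
          unfolding r_Suc vector_matrix_mult_def matrix_vector_mult_def
          by (simp add: sum_distrib_left sum_distrib_right mult_ac) (rule sum.swap)
        then have "t * (\<Sum>j\<in>UNIV. r (Suc m) $ j * v $ j)
            = (\<Sum>i\<in>UNIV. r m $ i * (E *v v) $ i) - (\<Sum>i\<in>UNIV. r m $ i * v $ i)"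
          by (simp add: Ev sum_distrib_left sum_subtractf sum.distrib algebra_simps)
        also have "p dvd \<dots>" using v by (intro dvd_diff[OF _ Suc.IH] dvd_sum) auto
        finally show ?case using p \<open>\<not> p dvd t\<close> by (simp add: prime_dvd_mult_iff)
      qed
      then have "p dvd (Ob *v v) $ i" for i
        by (simp add: Ob_def matrix_vector_mult_def)
      then have "p dvd v $ k * det Ob" by (rule kernel_mod_imp_dvd_det)
      with k \<open>\<not> p dvd t\<close> p show False by (simp add: prime_dvd_mult_iff t_def)
    qed
  qed
qed

section \<open>Coverings by simplices\<close>

text \<open>In coordinates: the translates by \<open>L\<close> of \<open>\<sigma> \<cdot> {x \<ge> 0. w \<bullet> x \<le> 1}\<close> cover the space.\<close>

definition weighted_covers :: "('n \<Rightarrow> real) \<Rightarrow> real \<Rightarrow> (real ^ 'n) set \<Rightarrow> bool" where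
  "weighted_covers w \<sigma> L \<longleftrightarrow>
    (\<forall>y. \<exists>l\<in>L. (\<forall>i. l $ i \<le> y $ i) \<and> (\<Sum>i\<in>UNIV. w i * (y $ i - l $ i)) \<le> \<sigma>)"

definition cong_lattice :: "('n \<Rightarrow> int) \<Rightarrow> int \<Rightarrow> (real ^ 'n) set" where
  "cong_lattice w d = {real_vec z | z. d dvd (\<Sum>i\<in>UNIV. w i * z $ i)}"

text \<open>The generator \<open>d\<close> is kept apart from the others because it becomes the
  modulus of the lattice.\<close>

definition pos_rep :: "('n::finite \<Rightarrow> int) \<Rightarrow> int \<Rightarrow> int \<Rightarrow> bool" where
  "pos_rep w d m \<longleftrightarrow> (\<exists>x y. (\<forall>i. 1 \<le> x i) \<and> 1 \<le> y \<and> m = (\<Sum>i\<in>UNIV. w i * x i) + d * y)"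

lemma weighted_covers_mono:
  "weighted_covers w \<sigma> L \<Longrightarrow> L \<subseteq> L' \<Longrightarrow> weighted_covers w \<sigma> L'"
  unfolding weighted_covers_def by blast

lemma lattice_of_eq_range: "lattice_of B = range (\<lambda>z. B *v real_vec z)"
proof -
  have "\<exists>z'. z = real_vec z'" if "\<forall>i. z $ i \<in> \<int>" for z :: "real ^ 'n"
    using that by (intro exI[of _ "\<chi> i. \<lfloor>z $ i\<rfloor>"]) (simp add: real_vec_def vec_eq_iff)
  moreover have "\<forall>i. real_vec z $ i \<in> \<int>" for z :: "int ^ 'n"
    by (simp add: real_vec_def)
  ultimately show ?thesis unfolding lattice_of_def by blast
qed

text \<open>Round down the coordinates with respect to the basis. The result makes the set of
  dilations in the inhomogeneous minimum nonempty, and it bounds the integers without a positive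
  representation.\<close>

lemma lattice_of_weighted_covers:
  fixes B :: "real ^ 'n ^ 'n"
  assumes B: "invertible B" and w: "\<And>i. 0 \<le> w i"
  shows "\<exists>\<sigma>>0. weighted_covers w \<sigma> (lattice_of B)"
proof -
  obtain C where C: "B ** C = mat 1" using B unfolding invertible_def by blast
  \<comment> \<open>\<open>K\<close> bounds every coordinate of \<open>B *v p\<close> for
    \<open>p\<close> in the unit cube. Aiming at \<open>y - K\<close> therefore puts the lattice
    point between \<open>y - 2 * K\<close> and \<open>y\<close>.\<close>
  define K where "K = (\<Sum>i\<in>UNIV. \<Sum>j\<in>UNIV. \<bar>B $ i $ j\<bar>)"
  have K: "0 \<le> K" unfolding K_def by (intro sum_nonneg) auto
  have row: "(\<Sum>j\<in>UNIV. \<bar>B $ i $ j\<bar>) \<le> K" for i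
    unfolding K_def by (rule member_le_sum[of i]) (auto intro: sum_nonneg)
  \<comment> \<open>The summand 1 keeps the dilation positive even if all weights vanish.\<close>
  have "weighted_covers w (1 + (\<Sum>i\<in>UNIV. w i * (2 * K))) (lattice_of B)"
    unfolding weighted_covers_def
  proof
    fix y :: "real ^ 'n"
    define c where "c = C *v (y - (\<chi> i. K))"
    define z :: "int ^ 'n" where "z = (\<chi> i. \<lfloor>c $ i\<rfloor>)"
    have Bc: "B *v c = y - (\<chi> i. K)"
      by (simp add: c_def matrix_vector_mul_assoc C)
    have "\<bar>(B *v (c - real_vec z)) $ i\<bar> \<le> K" for i
    proof -
      have "\<bar>(B *v (c - real_vec z)) $ i\<bar> \<le> (\<Sum>j\<in>UNIV. \<bar>B $ i $ j * (c - real_vec z) $ j\<bar>)"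
        unfolding matrix_vector_mult_def by (simp add: sum_abs)
      also have "\<dots> \<le> (\<Sum>j\<in>UNIV. \<bar>B $ i $ j\<bar>)"
      proof (rule sum_mono)
        fix j
        have "\<bar>(c - real_vec z) $ j\<bar> \<le> 1"
          unfolding z_def real_vec_def by simp linarith
        then show "\<bar>B $ i $ j * (c - real_vec z) $ j\<bar> \<le> \<bar>B $ i $ j\<bar>"
          by (simp add: abs_mult mult_left_le)
      qed
      finally show ?thesis using row[of i] by linarith
    qed
    moreover have "(B *v (c - real_vec z)) $ i = y $ i - K - (B *v real_vec z) $ i" for i
      by (simp add: matrix_vector_mult_diff_distrib Bc)
    ultimately have bd: "\<bar>y $ i - K - (B *v real_vec z) $ i\<bar> \<le> K" for i by metis
    have up: "y $ i - (B *v real_vec z) $ i \<le> 2 * K" for i using bd[of i] by linarith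
    have lo: "(B *v real_vec z) $ i \<le> y $ i" for i using bd[of i] by linarith
    have "(\<Sum>i\<in>UNIV. w i * (y $ i - (B *v real_vec z) $ i)) \<le> (\<Sum>i\<in>UNIV. w i * (2 * K))"
      by (intro sum_mono mult_left_mono up w)
    with lo show "\<exists>l\<in>lattice_of B. (\<forall>i. l $ i \<le> y $ i) \<and>
        (\<Sum>i\<in>UNIV. w i * (y $ i - l $ i)) \<le> 1 + (\<Sum>i\<in>UNIV. w i * (2 * K))"
      unfolding lattice_of_eq_range by (intro bexI[of _ "B *v real_vec z"]) auto
  qed
  moreover have "0 < 1 + (\<Sum>i\<in>UNIV. w i * (2 * K))"
    using K w by (intro add_pos_nonneg sum_nonneg mult_nonneg_nonneg) auto
  ultimately show ?thesis by blast
qed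

text \<open>Multiplying coordinate \<open>i\<close> by \<open>r * w i / v i\<close> maps the simplex
  with weights \<open>w\<close> and size \<open>\<sigma>\<close> onto the one with weights
  \<open>v\<close> and size \<open>r * \<sigma>\<close>. It is used both to reach unit weights and
  to return from them to an integer lattice.\<close>

lemma weighted_covers_scale:
  fixes B :: "real ^ 'n ^ 'n"
  assumes cov: "weighted_covers w \<sigma> (lattice_of B)" and r: "0 < r"
    and w: "\<And>i. 0 < w i" and v: "\<And>i. 0 < v i"
  shows "weighted_covers v (r * \<sigma>) (lattice_of (\<chi> i j. r * w i / v i * B $ i $ j))"
  unfolding weighted_covers_def
proof
  fix y :: "real ^ 'n"
  define B' :: "real ^ 'n ^ 'n" where "B' = (\<chi> i j. r * w i / v i * B $ i $ j)"
  obtain z where z: "\<And>i. (B *v real_vec z) $ i \<le> v i / (r * w i) * y $ i"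
    "(\<Sum>i\<in>UNIV. w i * (v i / (r * w i) * y $ i - (B *v real_vec z) $ i)) \<le> \<sigma>"
    using cov[unfolded weighted_covers_def, rule_format, of "\<chi> i. v i / (r * w i) * y $ i"]
    unfolding lattice_of_eq_range by auto
  have B': "(B' *v real_vec z) $ i = r * w i / v i * (B *v real_vec z) $ i" for i
    by (simp add: B'_def matrix_vector_mult_def sum_distrib_left mult.assoc)
  have "v i * (y $ i - (B' *v real_vec z) $ i)
      = r * (w i * (v i / (r * w i) * y $ i - (B *v real_vec z) $ i))" for i
    using r w[of i] v[of i] by (simp add: B' field_simps)
  then have "(\<Sum>i\<in>UNIV. v i * (y $ i - (B' *v real_vec z) $ i)) \<le> r * \<sigma>"
    using z(2) r by (simp flip: sum_distrib_left)
  moreover have "(B' *v real_vec z) $ i \<le> y $ i" for i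
    using z(1)[of i] r w[of i] v[of i] by (simp add: B' field_simps)
  ultimately show "\<exists>l\<in>lattice_of B'. (\<forall>i. l $ i \<le> y $ i) \<and> (\<Sum>i\<in>UNIV. v i * (y $ i - l $ i)) \<le> r * \<sigma>"
    unfolding lattice_of_eq_range by blast
qed

lemma det_scale_rows: "det (\<chi> i j. k i * B $ i $ j) = prod k UNIV * det (B :: real ^ 'n ^ 'n)"
proof -
  have "(\<chi> i j. k i * B $ i $ j) = (\<chi> i. k i *s B $ i)" by (simp add: vec_eq_iff)
  then show ?thesis using det_rows_mul[of k "\<lambda>i. B $ i"] by simp
qed

section \<open>The absolute inhomogeneous minimum of the simplex\<close>

lemma covering_lattice_simplex_iff:
  fixes B :: "real ^ 'n ^ 'n"
  assumes B: "invertible B" and s: "0 < \<sigma>"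
  shows "covering_lattice ((\<lambda>s. \<sigma> *\<^sub>R s) ` std_simplex) (lattice_of B)
    \<longleftrightarrow> weighted_covers (\<lambda>_. 1) \<sigma> (lattice_of B)"
proof -
  have mem: "x \<in> (\<lambda>s. \<sigma> *\<^sub>R s) ` std_simplex \<longleftrightarrow> (\<forall>i. 0 \<le> x $ i) \<and> (\<Sum>i\<in>UNIV. x $ i) \<le> \<sigma>"
    for x :: "real ^ 'n"
  proof
    assume "x \<in> (\<lambda>s. \<sigma> *\<^sub>R s) ` std_simplex"
    then show "(\<forall>i. 0 \<le> x $ i) \<and> (\<Sum>i\<in>UNIV. x $ i) \<le> \<sigma>"
      using s by (auto simp: std_simplex_def simp flip: sum_distrib_left intro: mult_left_le)
  next
    assume x: "(\<forall>i. 0 \<le> x $ i) \<and> (\<Sum>i\<in>UNIV. x $ i) \<le> \<sigma>"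
    then have "(1 / \<sigma>) *\<^sub>R x \<in> std_simplex"
      using s by (auto simp: std_simplex_def simp flip: sum_divide_distrib)
    moreover have "x = \<sigma> *\<^sub>R ((1 / \<sigma>) *\<^sub>R x)" using s by simp
    ultimately show "x \<in> (\<lambda>s. \<sigma> *\<^sub>R s) ` std_simplex" by blast
  qed
  have union: "y \<in> (\<Union>l\<in>L. (\<lambda>s. s + l) ` S) \<longleftrightarrow> (\<exists>l\<in>L. y - l \<in> S)" for y and L S :: "(real ^ 'n) set"
  proof
    assume "\<exists>l\<in>L. y - l \<in> S"
    then obtain l where "l \<in> L" "y - l \<in> S" by blast
    then show "y \<in> (\<Union>l\<in>L. (\<lambda>s. s + l) ` S)"
      by (intro UN_I[of l] image_eqI[of _ _ "y - l"]) auto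
  next
    assume "y \<in> (\<Union>l\<in>L. (\<lambda>s. s + l) ` S)"
    then obtain l s where "l \<in> L" "s \<in> S" "y = s + l" by blast
    then show "\<exists>l\<in>L. y - l \<in> S" by (intro bexI[of _ l]) auto
  qed
  have "(\<Union>l\<in>L. (\<lambda>s. s + l) ` S) = UNIV \<longleftrightarrow> (\<forall>y. \<exists>l\<in>L. y - l \<in> S)" for L S :: "(real ^ 'n) set"
    by (simp only: set_eq_iff union UNIV_I simp_thms)
  moreover have "is_lattice (lattice_of B)" using B by (auto simp: is_lattice_def)
  ultimately show ?thesis
    unfolding covering_lattice_def weighted_covers_def by (simp add: mem)
qed

lemma abs_inhom_min_simplex_le:
  fixes B :: "real ^ 'n ^ 'n"
  assumes B: "\<bar>det B\<bar> = 1" and s: "0 < \<sigma>" and cov: "weighted_covers (\<lambda>_. 1) \<sigma> (lattice_of B)"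
  shows "abs_inhom_min (std_simplex :: (real ^ 'n) set) \<le> \<sigma>"
proof -
  have inv: "invertible B" using B by (auto simp: invertible_det_nz)
  define X where "X L = {\<sigma>. 0 < \<sigma> \<and> covering_lattice ((\<lambda>s. \<sigma> *\<^sub>R s) ` std_simplex) L}"
    for L :: "(real ^ 'n) set"
  have im: "inhom_min std_simplex L = Inf (X L)" for L :: "(real ^ 'n) set"
    by (simp add: inhom_min_def X_def)
  \<comment> \<open>The bound is for every set \<open>L\<close>, lattice or not, so the value of
    \<open>Inf\<close> at the empty set has to be allowed for.\<close>
  have "min 0 (Inf {}) \<le> inhom_min std_simplex L" for L :: "(real ^ 'n) set"
  proof (cases "X L = {}")
    case False
    then have "0 \<le> Inf (X L)" by (intro cInf_greatest) (auto simp: X_def)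
    then show ?thesis by (simp add: im min_def)
  qed (simp add: im)
  then have "bdd_below {inhom_min std_simplex L | L :: (real ^ 'n) set. is_lattice L \<and> lattice_det L = 1}"
    by (auto intro!: bdd_belowI[of _ "min 0 (Inf {})"])
  moreover have "is_lattice (lattice_of B)" "lattice_det (lattice_of B) = 1"
    using inv B by (auto simp: is_lattice_def lattice_det_lattice_of)
  ultimately have "abs_inhom_min (std_simplex :: (real ^ 'n) set) \<le> inhom_min std_simplex (lattice_of B)"
    unfolding abs_inhom_min_def by (intro cInf_lower) auto
  also have "\<dots> \<le> \<sigma>"
    unfolding im
    by (rule cInf_lower) (use s cov inv in \<open>auto simp: X_def covering_lattice_simplex_iff intro!: bdd_belowI[of _ 0]\<close>)
  finally show ?thesis .
qed

text \<open>An infimum below \<open>r\<close> yields an element only if the set is nonempty: the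
  integer lattice serves for the outer infimum, \<open>lattice_of_weighted_covers\<close> for the
  inner one.\<close>

lemma abs_inhom_min_simplex_approx:
  assumes "abs_inhom_min (std_simplex :: (real ^ 'n) set) < r"
  obtains B :: "real ^ 'n ^ 'n" and \<sigma> where "\<bar>det B\<bar> = 1" "0 < \<sigma>" "\<sigma> < r"
    "weighted_covers (\<lambda>_. 1) \<sigma> (lattice_of B)"
proof -
  let ?S = "{inhom_min std_simplex L | L :: (real ^ 'n) set. is_lattice L \<and> lattice_det L = 1}"
  have "is_lattice (lattice_of (mat 1 :: real ^ 'n ^ 'n))" "lattice_det (lattice_of (mat 1 :: real ^ 'n ^ 'n)) = 1"
    by (auto simp: is_lattice_def lattice_det_lattice_of invertible_det_nz intro!: exI[of _ "mat 1"])
  then have "?S \<noteq> {}" by blast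
  then obtain L :: "(real ^ 'n) set" where L: "is_lattice L" "lattice_det L = 1" "inhom_min std_simplex L < r"
    using assms cInf_lessD[of ?S r] unfolding abs_inhom_min_def by auto
  from L(1) obtain B where B: "invertible B" "L = lattice_of B" by (auto simp: is_lattice_def)
  obtain \<sigma>0 where "\<sigma>0 > 0" "weighted_covers (\<lambda>_. 1) \<sigma>0 (lattice_of B)"
    using lattice_of_weighted_covers[OF B(1), of "\<lambda>_. 1"] by auto
  then have "{\<sigma>. 0 < \<sigma> \<and> covering_lattice ((\<lambda>s. \<sigma> *\<^sub>R s) ` std_simplex) L} \<noteq> {}"
    using B by (auto simp: covering_lattice_simplex_iff)
  from cInf_lessD[OF this L(3)[unfolded inhom_min_def]]
  obtain \<sigma> where "\<sigma> < r" "0 < \<sigma>" "covering_lattice ((\<lambda>s. \<sigma> *\<^sub>R s) ` std_simplex) L"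
    by blast
  then show thesis
    using that[of B \<sigma>] B L(2) by (simp add: covering_lattice_simplex_iff lattice_det_lattice_of)
qed

section \<open>Positive representations and coverings\<close>

text \<open>Cover a point near \<open>m * u\<close>. The difference \<open>x\<close> between
  \<open>m * u\<close> and the lattice point has weighted sum congruent to \<open>m\<close> modulo
  \<open>d\<close>, and the covering bound keeps this sum below \<open>m\<close>, which leaves a
  positive multiple of \<open>d\<close>.\<close>

lemma pos_rep_if_covers:
  fixes w :: "'n::finite \<Rightarrow> int"
  assumes w: "\<And>i. 0 < w i" and d: "0 < d"
    and bez: "(\<Sum>i\<in>UNIV. w i * u i) + d * k = 1"
    and cov: "weighted_covers (\<lambda>i. real_of_int (w i)) \<sigma> (cong_lattice w d)" and m: "\<sigma> < real_of_int m"
  shows "pos_rep w d m"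
proof -
  define W where "W = (\<Sum>i\<in>UNIV. real_of_int (w i))"
  have W: "0 < W" unfolding W_def using w by (intro sum_pos) auto
  \<comment> \<open>Lowering the target by \<open>\<delta>\<close> makes every \<open>x i\<close>
    strictly positive; this \<open>\<delta>\<close> costs only half of the gap between
    \<open>\<sigma>\<close> and \<open>m\<close>.\<close>
  define \<delta> where "\<delta> = (m - \<sigma>) / (2 * W)"
  have \<delta>: "0 < \<delta>" "\<sigma> + \<delta> * W < m" using m W by (auto simp: \<delta>_def field_simps)
  obtain z where z: "d dvd (\<Sum>i\<in>UNIV. w i * z $ i)" "\<And>i. z $ i \<le> m * u i - \<delta>"
    "(\<Sum>i\<in>UNIV. w i * (m * u i - \<delta> - z $ i)) \<le> \<sigma>"
    using cov[unfolded weighted_covers_def, rule_format, of "\<chi> i. m * u i - \<delta>"]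
    unfolding cong_lattice_def by (auto simp: real_vec_def)
  define x where "x i = m * u i - z $ i" for i
  have "1 \<le> x i" for i
  proof -
    have "real_of_int (z $ i) < m * u i" using z(2)[of i] \<delta> by linarith
    then have "z $ i < m * u i" by (metis of_int_less_iff of_int_mult)
    then show ?thesis by (simp add: x_def)
  qed
  obtain q where q: "(\<Sum>i\<in>UNIV. w i * z $ i) = d * q" using z(1) by blast
  have "(\<Sum>i\<in>UNIV. w i * x i) = m * (\<Sum>i\<in>UNIV. w i * u i) - d * q"
    by (simp add: x_def right_diff_distrib sum_subtractf q sum_distrib_left mult_ac)
  also have "(\<Sum>i\<in>UNIV. w i * u i) = 1 - d * k" using bez by simp
  also have "m * (1 - d * k) - d * q = m - d * (m * k + q)" by (simp add: algebra_simps)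
  finally have eq: "m = (\<Sum>i\<in>UNIV. w i * x i) + d * (m * k + q)" by simp
  have "(\<Sum>i\<in>UNIV. w i * (m * u i - \<delta> - z $ i)) = real_of_int (\<Sum>i\<in>UNIV. w i * x i) - \<delta> * W"
    by (simp add: W_def x_def right_diff_distrib sum_subtractf sum_distrib_left mult_ac)
  with z(3) \<delta>(2) have "real_of_int (\<Sum>i\<in>UNIV. w i * x i) < m" by linarith
  then have "0 < d * (m * k + q)" using eq by linarith
  then have "1 \<le> m * k + q" using d by (simp add: zero_less_mult_iff)
  with eq \<open>\<And>i. 1 \<le> x i\<close> show ?thesis unfolding pos_rep_def by blast
qed

text \<open>Round \<open>y\<close> up and subtract the coefficients of a representation of some
  \<open>m\<close> in the right residue class. Coefficients at least 1 bring the rounded point below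
  \<open>y\<close>, and the term \<open>d * q \<ge> d\<close> brings the weighted sum from at most
  \<open>F + d\<close> down to at most \<open>F\<close>.\<close>

lemma covers_if_pos_rep:
  fixes w :: "'n::finite \<Rightarrow> int"
  assumes w: "\<And>i. 0 < w i" and d: "0 < d" and rep: "\<And>m. F < m \<Longrightarrow> pos_rep w d m"
  shows "weighted_covers (\<lambda>i. real_of_int (w i)) (real_of_int F) (cong_lattice w d)"
  unfolding weighted_covers_def
proof
  fix y :: "real ^ 'n"
  define r where "r = (\<Sum>i\<in>UNIV. w i * \<lceil>y $ i\<rceil>)"
  \<comment> \<open>The representative of \<open>r\<close> modulo \<open>d\<close> that lies above
    \<open>F\<close> and is at most \<open>F + d\<close>.\<close>
  define m where "m = F + d - (F - r) mod d"
  have "F < m" "m \<le> F + d" using d by (auto simp: m_def)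
  obtain x q where x: "\<And>i. 1 \<le> x i" "1 \<le> q" "m = (\<Sum>i\<in>UNIV. w i * x i) + d * q"
    using rep[OF \<open>F < m\<close>] unfolding pos_rep_def by blast
  define z :: "int ^ 'n" where "z = (\<chi> i. \<lceil>y $ i\<rceil> - x i)"
  have "m = r + d * (1 + (F - r) div d)"
    using mult_div_mod_eq[of d "F - r"] unfolding m_def by (simp add: algebra_simps)
  then have "(\<Sum>i\<in>UNIV. w i * z $ i) = d * (q - 1 - (F - r) div d)"
    using x(3) by (simp add: z_def r_def right_diff_distrib sum_subtractf algebra_simps)
  then have "real_vec z \<in> cong_lattice w d" unfolding cong_lattice_def by auto
  moreover have "real_vec z $ i \<le> y $ i" for i
  proof -
    have "real_of_int \<lceil>y $ i\<rceil> < y $ i + 1" by linarith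
    moreover have "1 \<le> real_of_int (x i)" using x(1)[of i] by simp
    ultimately show ?thesis by (simp add: z_def real_vec_def)
  qed
  moreover have "(\<Sum>i\<in>UNIV. w i * (y $ i - real_vec z $ i)) \<le> F"
  proof -
    have "(\<Sum>i\<in>UNIV. w i * (y $ i - real_vec z $ i)) \<le> (\<Sum>i\<in>UNIV. real_of_int (w i * x i))"
    proof (rule sum_mono)
      fix i
      have "y $ i - real_vec z $ i \<le> x i" by (simp add: z_def real_vec_def)
      then show "w i * (y $ i - real_vec z $ i) \<le> real_of_int (w i * x i)"
        using w[of i] by simp
    qed
    also have "\<dots> = real_of_int (m - d * q)" using x(3) by simp
    also have "m - d * q \<le> F"
      using \<open>m \<le> F + d\<close> mult_left_mono[OF x(2), of d] d by linarith
    finally show ?thesis by simp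
  qed
  ultimately show "\<exists>l\<in>cong_lattice w d. (\<forall>i. l $ i \<le> y $ i) \<and> (\<Sum>i\<in>UNIV. w i * (y $ i - l $ i)) \<le> F"
    by blast
qed

text \<open>This explicit full-rank sublattice supplies a covering, and a starting matrix for the
  search for a basis.\<close>

lemma multiples_subset_cong_lattice:
  "lattice_of ((\<chi> i j. if i = j then real_of_int d else 0) :: real ^ 'n ^ 'n) \<subseteq> cong_lattice w d"
proof -
  have "(\<chi> i j. if i = j then real_of_int d else 0) *v real_vec z = real_vec (\<chi> i. d * z $ i)"
    for z :: "int ^ 'n"
    by (simp add: matrix_vector_mult_def real_vec_def vec_eq_iff if_distrib[of "\<lambda>x. x * _"] cong: if_cong)
  moreover have "d dvd (\<Sum>i\<in>UNIV. w i * (\<chi> i. d * z $ i) $ i)" for z :: "int ^ 'n"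
    by (intro dvd_sum) auto
  ultimately show ?thesis
    unfolding lattice_of_eq_range cong_lattice_def by (auto simp del: vec_lambda_beta)
qed

text \<open>\<open>GREATEST\<close> has its intended value because a maximum exists: 0 is not
  representable, and a covering by the multiples of \<open>d\<close> bounds the non-representable
  integers above.\<close>

lemma Greatest_not_pos_rep:
  fixes w :: "'n::finite \<Rightarrow> int"
  assumes w: "\<And>i. 0 < w i" and d: "0 < d"
    and bez: "(\<Sum>i\<in>UNIV. w i * u i) + d * k = 1"
  defines "F \<equiv> GREATEST m. \<not> pos_rep w d m"
  shows "\<not> pos_rep w d F" and "\<And>m. F < m \<Longrightarrow> pos_rep w d m"
proof -
  have "invertible ((\<chi> i j. if i = j then real_of_int d else 0) :: real ^ 'n ^ 'n)"
    using d by (simp add: invertible_det_nz det_diagonal)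
  from lattice_of_weighted_covers[OF this, of "\<lambda>i. real_of_int (w i)"] w
  obtain \<sigma> where "weighted_covers (\<lambda>i. real_of_int (w i)) \<sigma>
      (lattice_of ((\<chi> i j. if i = j then real_of_int d else 0) :: real ^ 'n ^ 'n))"
    by (auto simp: less_imp_le)
  then have "weighted_covers (\<lambda>i. real_of_int (w i)) \<sigma> (cong_lattice w d)"
    by (rule weighted_covers_mono[OF _ multiples_subset_cong_lattice])
  then have big: "pos_rep w d m" if "\<sigma> < real_of_int m" for m
    using pos_rep_if_covers[OF w d bez] that by blast
  have "\<not> pos_rep w d 0"
  proof
    assume "pos_rep w d 0"
    then obtain x q where "\<And>i. 1 \<le> x i" "1 \<le> q" "0 = (\<Sum>i\<in>UNIV. w i * x i) + d * q"
      unfolding pos_rep_def by blast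
    moreover have "0 < d * q" using d \<open>1 \<le> q\<close> by simp
    moreover have "0 \<le> w i * x i" for i
      using w[of i] \<open>\<And>i. 1 \<le> x i\<close>[of i] by simp
    then have "0 \<le> (\<Sum>i\<in>UNIV. w i * x i)" by (intro sum_nonneg)
    ultimately show False by linarith
  qed
  \<comment> \<open>The maximum with 0 ensures that the downward search from \<open>C\<close> meets
    the non-representable integer 0.\<close>
  define C where "C = max 0 \<lceil>\<sigma>\<rceil>"
  have C: "m \<le> C" if "\<not> pos_rep w d m" for m
    using big[of m] that unfolding C_def by linarith
  define j where "j = (LEAST j. \<not> pos_rep w d (C - int j))"
  have "\<not> pos_rep w d (C - int (nat C))" using \<open>\<not> pos_rep w d 0\<close> by (simp add: C_def)
  then have j: "\<not> pos_rep w d (C - int j)" unfolding j_def by (rule LeastI)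
  have max: "m \<le> C - int j" if "\<not> pos_rep w d m" for m
  proof -
    have "\<not> pos_rep w d (C - int (nat (C - m)))" using that C[OF that] by simp
    then have "j \<le> nat (C - m)" unfolding j_def by (rule Least_le)
    then show ?thesis using C[OF that] by linarith
  qed
  have "F = C - int j" unfolding F_def by (rule Greatest_equality) (use j max in auto)
  then show "\<not> pos_rep w d F" "\<And>m. F < m \<Longrightarrow> pos_rep w d m"
    using j max by (auto simp: not_less[symmetric])
qed

section \<open>Bases of congruence lattices\<close>

lemma int_subgroup_eq_lattice_of:
  fixes \<Lambda> :: "(real ^ 'n) set" and B0 :: "real ^ 'n ^ 'n"
  assumes int: "\<And>x i. x \<in> \<Lambda> \<Longrightarrow> x $ i \<in> \<int>"
    and diff: "\<And>x y. x \<in> \<Lambda> \<Longrightarrow> y \<in> \<Lambda> \<Longrightarrow> x - y \<in> \<Lambda>"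
    and B0: "invertible B0" "lattice_of B0 \<subseteq> \<Lambda>"
  shows "\<exists>B. invertible B \<and> lattice_of B = \<Lambda>"
proof -
  define Q where "Q B \<longleftrightarrow> invertible B \<and> lattice_of B \<subseteq> \<Lambda>" for B :: "real ^ 'n ^ 'n"
  have col: "column j B \<in> lattice_of B" for j and B :: "real ^ 'n ^ 'n"
    unfolding lattice_of_def
    by (simp, rule exI[of _ "axis j 1"]) (simp add: matrix_vector_mult_basis, simp add: axis_def)
  have zero: "0 \<in> \<Lambda>" using col[of _ B0] B0(2) diff by (metis diff_self subsetD)
  have add: "x + y \<in> \<Lambda>" if "x \<in> \<Lambda>" "y \<in> \<Lambda>" for x y
    using diff[OF that(1) diff[OF zero that(2)]] by simp
  have smult: "of_int k *s x \<in> \<Lambda>" if x: "x \<in> \<Lambda>" for k x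
  proof (induction k rule: int_induct[of _ 0])
    case (step1 i)
    then show ?case using add[OF _ x] by (simp add: vector_sadd_rdistrib)
  next
    case (step2 i)
    then show ?case using diff[OF _ x] by (simp add: vector_sub_rdistrib)
  qed (simp add: zero)
  have gen: "lattice_of B \<subseteq> \<Lambda>" if "\<And>j. column j B \<in> \<Lambda>" for B :: "real ^ 'n ^ 'n"
  proof -
    have "(\<Sum>j\<in>J. of_int (z $ j) *s column j B) \<in> \<Lambda>" for z :: "int ^ 'n" and J :: "'n set"
      by (induction J rule: infinite_finite_induct) (auto simp: zero intro!: add smult that)
    moreover have "B *v real_vec z = (\<Sum>j\<in>UNIV. of_int (z $ j) *s column j B)" for z
      by (simp add: matrix_mult_sum real_vec_def)
    ultimately show ?thesis unfolding lattice_of_eq_range by auto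
  qed
  have detint: "det B \<in> \<int>" if "Q B" for B
  proof -
    have "B $ i $ j \<in> \<int>" for i j
      using that col[of j B] int[of "column j B" i] by (auto simp: Q_def column_def)
    then show ?thesis unfolding det_def by (intro Ints_sum Ints_mult Ints_prod) auto
  qed
  \<comment> \<open>A sublattice of minimal determinant is everything: otherwise a point with a fractional
    coordinate could replace a column and shrink the determinant.\<close>
  have "Q B0" using B0 by (simp add: Q_def)
  then obtain B where B: "Q B" and least: "\<And>C. Q C \<Longrightarrow> nat \<lfloor>\<bar>det B\<bar>\<rfloor> \<le> nat \<lfloor>\<bar>det C\<bar>\<rfloor>"
    using ex_has_least_nat[of Q B0 "\<lambda>B. nat \<lfloor>\<bar>det B\<bar>\<rfloor>"] by blast
  have least': "\<bar>det B\<bar> \<le> \<bar>det C\<bar>" if C: "Q C" for C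
  proof -
    obtain b c where "det B = of_int b" "det C = of_int c"
      using detint[OF B] detint[OF C] by (auto elim!: Ints_cases)
    then show ?thesis using least[OF C] by (simp add: nat_le_iff flip: of_int_abs)
  qed
  have "x \<in> lattice_of B" if x: "x \<in> \<Lambda>" for x
  proof -
    obtain C where C: "B ** C = mat 1" using B unfolding Q_def invertible_def by blast
    define c where "c = C *v x"
    define z :: "int ^ 'n" where "z = (\<chi> i. \<lfloor>c $ i\<rfloor>)"
    have Bc: "B *v c = x" by (simp add: c_def matrix_vector_mul_assoc C)
    define x' where "x' = B *v (c - real_vec z)"
    have "B *v real_vec z \<in> lattice_of B" unfolding lattice_of_eq_range by blast
    then have "B *v real_vec z \<in> \<Lambda>" using B by (auto simp: Q_def)
    then have x': "x' \<in> \<Lambda>" using diff[OF x] by (simp add: x'_def matrix_vector_mult_diff_distrib Bc)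
    have fr: "0 \<le> (c - real_vec z) $ j" "(c - real_vec z) $ j < 1" for j
      unfolding z_def real_vec_def by (simp_all; linarith)+
    have "(c - real_vec z) $ k = 0" for k
    proof (rule ccontr)
      assume nz: "(c - real_vec z) $ k \<noteq> 0"
      define D :: "real ^ 'n ^ 'n" where "D = (\<chi> i j. if j = k then x' $ i else B $ i $ j)"
      have det: "det D = (c - real_vec z) $ k * det B"
        unfolding D_def x'_def by (rule cramer_lemma)
      have B': "det B \<noteq> 0" using B by (simp add: Q_def invertible_det_nz)
      have "column j D = (if j = k then x' else column j B)" for j
        by (simp add: column_def D_def vec_eq_iff)
      moreover have "column j B \<in> \<Lambda>" for j using col[of j B] B by (auto simp: Q_def)
      ultimately have "lattice_of D \<subseteq> \<Lambda>" using x' by (intro gen) simp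
      moreover have "det D \<noteq> 0" using nz B' by (simp only: det mult_eq_0_iff simp_thms)
      ultimately have "Q D" by (simp add: Q_def invertible_det_nz)
      then have "\<bar>det B\<bar> \<le> \<bar>(c - real_vec z) $ k\<bar> * \<bar>det B\<bar>"
        using least'[of D] by (simp only: det abs_mult)
      moreover have "\<bar>(c - real_vec z) $ k\<bar> * \<bar>det B\<bar> < 1 * \<bar>det B\<bar>"
        using fr[of k] B' by (intro mult_strict_right_mono) auto
      ultimately show False by simp
    qed
    then have "c = real_vec z" by (simp add: vec_eq_iff)
    with Bc show ?thesis unfolding lattice_of_eq_range by blast
  qed
  with B show ?thesis by (auto simp: Q_def)
qed

text \<open>Each column of a basis matrix has weighted sum 0 modulo \<open>d\<close>, so
  \<open>w\<close> is a kernel vector of the transposed matrix modulo \<open>d\<close>. With the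
  Bezout identity, \<open>d\<close> divides the determinant, which is nonzero.\<close>

lemma cong_lattice_basis:
  fixes w :: "'n::finite \<Rightarrow> int"
  assumes d: "0 < d" and bez: "(\<Sum>i\<in>UNIV. w i * u i) + d * k = 1"
  obtains B where "invertible B" "lattice_of B = cong_lattice w d" "real_of_int d \<le> \<bar>det B\<bar>"
proof -
  have "\<exists>B. invertible B \<and> lattice_of B = cong_lattice w d"
  proof (rule int_subgroup_eq_lattice_of[OF _ _ _ multiples_subset_cong_lattice])
    show "x $ i \<in> \<int>" if "x \<in> cong_lattice w d" for x i
      using that by (auto simp: cong_lattice_def real_vec_def)
    show "x - y \<in> cong_lattice w d" if "x \<in> cong_lattice w d" "y \<in> cong_lattice w d" for x y
    proof -
      obtain a b where ab: "x = real_vec a" "y = real_vec b"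
        "d dvd (\<Sum>i\<in>UNIV. w i * a $ i)" "d dvd (\<Sum>i\<in>UNIV. w i * b $ i)"
        using \<open>x \<in> _\<close> \<open>y \<in> _\<close> by (auto simp: cong_lattice_def)
      have "x - y = real_vec (a - b)" by (simp add: ab real_vec_def vec_eq_iff)
      moreover have "d dvd (\<Sum>i\<in>UNIV. w i * (a - b) $ i)"
        using dvd_diff[OF ab(3,4)] by (simp add: right_diff_distrib sum_subtractf)
      ultimately show ?thesis unfolding cong_lattice_def by blast
    qed
    show "invertible ((\<chi> i j. if i = j then real_of_int d else 0) :: real ^ 'n ^ 'n)"
      using d by (simp add: invertible_det_nz det_diagonal)
  qed
  then obtain B where B: "invertible B" "lattice_of B = cong_lattice w d" by blast
  have "\<exists>z. B *v axis j 1 = real_vec z \<and> d dvd (\<Sum>i\<in>UNIV. w i * z $ i)" for j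
  proof -
    have "B *v axis j 1 \<in> lattice_of B" unfolding lattice_of_def by (auto simp: axis_def)
    then show ?thesis unfolding B(2) cong_lattice_def by blast
  qed
  then obtain b where b: "\<And>j. B *v axis j 1 = real_vec (b j)" "\<And>j. d dvd (\<Sum>i\<in>UNIV. w i * b j $ i)"
    by metis
  define M :: "int ^ 'n ^ 'n" where "M = (\<chi> i j. b j $ i)"
  have "B = real_mat M"
    using b(1) by (simp add: M_def real_mat_def real_vec_def vec_eq_iff matrix_vector_mult_basis column_def)
  have "d dvd (transpose M *v (\<chi> i. w i)) $ j" for j
    using b(2)[of j] by (simp add: transpose_def M_def matrix_vector_mult_def mult.commute)
  from kernel_mod_imp_dvd_det[OF this] have "d dvd w i * det M" for i by simp
  then have "d dvd (\<Sum>i\<in>UNIV. u i * (w i * det M)) + d * (k * det M)"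
    by (intro dvd_add dvd_sum) auto
  also have "\<dots> = ((\<Sum>i\<in>UNIV. w i * u i) + d * k) * det M"
    by (simp add: sum_distrib_left sum_distrib_right algebra_simps)
  finally have "d dvd det M" by (simp add: bez)
  moreover have "det M \<noteq> 0" using B(1) by (simp add: \<open>B = real_mat M\<close> invertible_det_nz det_real_mat)
  ultimately have "d \<le> \<bar>det M\<bar>" using dvd_imp_le_int[of "det M" d] d by simp
  then have "real_of_int d \<le> \<bar>det B\<bar>"
    unfolding \<open>B = real_mat M\<close> det_real_mat by linarith
  with B show thesis using that by blast
qed

section \<open>Approximation of lattices\<close>

lemma tendsto_det:
  fixes A :: "real ^ 'n ^ 'n"
  assumes "\<And>i j. ((\<lambda>s. X s $ i $ j) \<longlongrightarrow> A $ i $ j) F"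
  shows "((\<lambda>s. det (X s)) \<longlongrightarrow> det A) F"
  unfolding det_def by (intro tendsto_intros assms)

text \<open>Cover in the coordinates of \<open>B0\<close> and read the same integer vector
  \<open>z\<close> in those of \<open>X s\<close>. The remainder \<open>p\<close> is bounded because
  \<open>B0 *v p\<close> lies in the simplex, so \<open>X s *v p\<close> is uniformly close to it;
  lowering the target by \<open>\<eta>\<close> restores the sign conditions.\<close>

lemma weighted_covers_perturb:
  fixes B0 :: "real ^ 'n ^ 'n"
  assumes B0: "invertible B0" and \<sigma>: "0 < \<sigma>" and cov: "weighted_covers (\<lambda>_. 1) \<sigma> (lattice_of B0)"
    and X: "\<And>i j. ((\<lambda>s. X s $ i $ j) \<longlongrightarrow> B0 $ i $ j) F" and \<delta>: "0 < \<delta>"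
  shows "\<forall>\<^sub>F s in F. weighted_covers (\<lambda>_. 1) (\<sigma> + \<delta>) (lattice_of (X s))"
proof -
  obtain C where C: "B0 ** C = mat 1" "C ** B0 = mat 1" using B0 unfolding invertible_def by blast
  define n where "n = real CARD('n)"
  have n: "0 < n" by (simp add: n_def)
  define K where "K = 1 + (\<Sum>j\<in>UNIV. \<Sum>k\<in>UNIV. \<bar>C $ j $ k\<bar>)"
  have K: "0 < K" unfolding K_def by (intro add_pos_nonneg sum_nonneg) auto
  have rowC: "(\<Sum>k\<in>UNIV. \<bar>C $ j $ k\<bar>) \<le> K" for j
    using member_le_sum[of j UNIV "\<lambda>j. \<Sum>k\<in>UNIV. \<bar>C $ j $ k\<bar>"] by (simp add: K_def sum_nonneg)
  \<comment> \<open>Over \<open>n\<close> coordinates, \<open>2 * \<eta>\<close> adds up to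
    \<open>\<delta>\<close>, and \<open>\<kappa>\<close> is such that entrywise errors below it
    change a coordinate by at most \<open>n * \<kappa> * (K * \<sigma>) = \<eta>\<close>.\<close>
  define \<eta> where "\<eta> = \<delta> / (2 * n)"
  define \<kappa> where "\<kappa> = \<eta> / (n * (K * \<sigma>))"
  have pos: "0 < \<eta>" "0 < \<kappa>" using \<delta> n K \<sigma> by (auto simp: \<eta>_def \<kappa>_def)
  have "\<forall>\<^sub>F s in F. \<bar>X s $ i $ j - B0 $ i $ j\<bar> < \<kappa>" for i j
    using tendstoD[OF X pos(2)] by (simp add: dist_real_def)
  then have "\<forall>\<^sub>F s in F. \<forall>i j. \<bar>X s $ i $ j - B0 $ i $ j\<bar> < \<kappa>"
    by (intro eventually_all_finite)
  moreover have "\<forall>\<^sub>F s in F. det (X s) \<noteq> 0"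
    using tendsto_det[OF X] B0 by (intro tendsto_imp_eventually_ne) (auto simp: invertible_det_nz)
  ultimately show ?thesis
  proof eventually_elim
    case (elim s)
    obtain D where D: "X s ** D = mat 1"
      using elim(2) unfolding invertible_det_nz[symmetric] invertible_def by blast
    show ?case
      unfolding weighted_covers_def
    proof
      fix y :: "real ^ 'n"
      define q where "q = D *v (y - (\<chi> i. \<eta>))"
      have q: "X s *v q = y - (\<chi> i. \<eta>)" by (simp add: q_def matrix_vector_mul_assoc D)
      obtain z where z: "\<And>i. (B0 *v real_vec z) $ i \<le> (B0 *v q) $ i"
        "(\<Sum>i\<in>UNIV. (B0 *v q) $ i - (B0 *v real_vec z) $ i) \<le> \<sigma>"
        using cov[unfolded weighted_covers_def, rule_format, of "B0 *v q"]
        unfolding lattice_of_eq_range by auto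
      define p where "p = q - real_vec z"
      define e where "e = B0 *v p"
      have e0: "0 \<le> e $ i" for i
        using z(1)[of i] by (simp add: e_def p_def matrix_vector_mult_diff_distrib)
      have es: "(\<Sum>i\<in>UNIV. e $ i) \<le> \<sigma>"
        using z(2) by (simp add: e_def p_def matrix_vector_mult_diff_distrib)
      have e1: "e $ k \<le> \<sigma>" for k
        using member_le_sum[of k UNIV "\<lambda>i. e $ i"] e0 es by force
      have p: "p = C *v e" by (simp add: e_def matrix_vector_mul_assoc C)
      have pb: "\<bar>p $ j\<bar> \<le> K * \<sigma>" for j
      proof -
        have "\<bar>p $ j\<bar> \<le> (\<Sum>k\<in>UNIV. \<bar>C $ j $ k * e $ k\<bar>)"
          unfolding p matrix_vector_mult_def by (simp add: sum_abs)
        also have "\<dots> \<le> (\<Sum>k\<in>UNIV. \<bar>C $ j $ k\<bar> * \<sigma>)"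
          using e0 e1 by (intro sum_mono) (auto simp: abs_mult intro!: mult_left_mono)
        also have "\<dots> = (\<Sum>k\<in>UNIV. \<bar>C $ j $ k\<bar>) * \<sigma>" by (simp add: sum_distrib_right)
        also have "\<dots> \<le> K * \<sigma>" using rowC[of j] \<sigma> by (intro mult_right_mono) auto
        finally show ?thesis .
      qed
      have close: "\<bar>(X s *v p) $ i - e $ i\<bar> \<le> \<eta>" for i
      proof -
        have "(X s *v p) $ i - e $ i = (\<Sum>j\<in>UNIV. (X s $ i $ j - B0 $ i $ j) * p $ j)"
          by (simp add: e_def matrix_vector_mult_def sum_subtractf left_diff_distrib)
        also have "\<bar>\<dots>\<bar> \<le> (\<Sum>j\<in>UNIV. \<bar>(X s $ i $ j - B0 $ i $ j) * p $ j\<bar>)"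
          by (rule sum_abs)
        also have "\<dots> \<le> (\<Sum>j\<in>(UNIV :: 'n set). \<kappa> * (K * \<sigma>))"
          using elim(1) pb pos unfolding abs_mult
          by (intro sum_mono mult_mono) (auto simp: less_imp_le)
        also have "\<dots> = \<eta>" using n K \<sigma> by (simp add: \<kappa>_def n_def)
        finally show ?thesis .
      qed
      have Xp: "y $ i - (X s *v real_vec z) $ i = (X s *v p) $ i + \<eta>" for i
        by (simp add: p_def matrix_vector_mult_diff_distrib q)
      have "(X s *v real_vec z) $ i \<le> y $ i" for i
        using Xp[of i] close[of i] e0[of i] by linarith
      moreover have "(\<Sum>i\<in>UNIV. y $ i - (X s *v real_vec z) $ i) \<le> (\<Sum>i\<in>UNIV. e $ i + 2 * \<eta>)"
      proof (rule sum_mono)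
        show "y $ i - (X s *v real_vec z) $ i \<le> e $ i + 2 * \<eta>" for i
          using Xp[of i] close[of i] by linarith
      qed
      moreover have "(\<Sum>i\<in>UNIV. e $ i + 2 * \<eta>) = (\<Sum>i\<in>UNIV. e $ i) + \<delta>"
        using n by (simp add: sum.distrib \<eta>_def n_def)
      ultimately show "\<exists>l\<in>lattice_of (X s). (\<forall>i. l $ i \<le> y $ i) \<and> (\<Sum>i\<in>UNIV. 1 * (y $ i - l $ i)) \<le> \<sigma> + \<delta>"
        using es unfolding lattice_of_eq_range
        by (intro bexI[of _ "X s *v real_vec z"]) auto
    qed
  qed
qed

section \<open>Tuples of maximal minors\<close>

lemma det_replace_row_combination:
  fixes M :: "real ^ 'n ^ 'n"
  shows "det (replace_row M k (x v* M)) = x $ k * det M"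
proof -
  have "replace_row M k (x v* M)
      = (\<chi> i. if i = k then \<Sum>i\<in>UNIV. x $ i *s row i M else row i M)"
    by (simp add: replace_row_def vec_eq_iff vector_matrix_mult_def row_def mult.commute)
  then show ?thesis by (simp only: cramer_lemma_transpose)
qed

text \<open>Write \<open>c\<close> over the reals as \<open>x v* M\<close>; by Cramer's rule the
  minors are \<open>x $ i * det M\<close>. The resulting relation says that the signed maximal
  minors annihilate every column of \<open>M\<close> extended by \<open>c\<close>.\<close>

lemma sum_det_replace_row:
  fixes M :: "int ^ 'n ^ 'n"
  assumes "det M \<noteq> 0"
  shows "(\<Sum>i\<in>UNIV. det (replace_row M i c) * M $ i $ j) = det M * c $ j"
proof -
  define R where "R = real_mat M"
  have "det R \<noteq> 0" using assms by (simp add: R_def det_real_mat)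
  then obtain C where C: "C ** R = mat 1"
    unfolding invertible_det_nz[symmetric] invertible_def by blast
  define x where "x = real_vec c v* C"
  have x: "x v* R = real_vec c" by (simp add: x_def vector_matrix_mul_assoc C)
  have "real_of_int (det (replace_row M i c)) = x $ i * det R" for i
  proof -
    have "real_of_int (det (replace_row M i c)) = det (replace_row R i (x v* R))"
      unfolding x unfolding R_def by (simp only: det_real_mat flip: real_mat_replace_row)
    then show ?thesis by (simp only: det_replace_row_combination)
  qed
  then have "real_of_int (\<Sum>i\<in>UNIV. det (replace_row M i c) * M $ i $ j)
      = det R * (x v* R) $ j"
    by (simp add: R_def real_mat_def vector_matrix_mult_def sum_distrib_left mult_ac)
  also have "\<dots> = real_of_int (det M * c $ j)"
    unfolding x by (simp add: R_def det_real_mat real_vec_def)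
  finally show ?thesis by (simp only: of_int_eq_iff)
qed

text \<open>By \<open>sum_det_replace_row\<close>, column \<open>j\<close> of \<open>E\<close> has
  weighted sum \<open>- s * det E * c $ j\<close>, a multiple of the modulus. Later \<open>s\<close>
  is the sign that makes the modulus positive, and the minus sign compensates for an extra row near
  a multiple of \<open>- \<alpha> A\<close>.\<close>

lemma lattice_subset_cong_lattice:
  fixes E :: "int ^ 'n ^ 'n" and s :: int
  assumes "det E \<noteq> 0"
  shows "lattice_of (real_mat E) \<subseteq> cong_lattice (\<lambda>i. - s * det (replace_row E i c)) (s * det E)"
proof -
  have "s * det E dvd (\<Sum>i\<in>UNIV. - s * det (replace_row E i c) * (E *v z) $ i)" for z
  proof -
    have "(\<Sum>i\<in>UNIV. - s * det (replace_row E i c) * (E *v z) $ i)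
        = (\<Sum>i\<in>UNIV. \<Sum>j\<in>UNIV. - s * (det (replace_row E i c) * E $ i $ j) * z $ j)"
      by (simp add: matrix_vector_mult_def sum_distrib_left mult_ac)
    also have "\<dots> = (\<Sum>j\<in>UNIV. \<Sum>i\<in>UNIV. - s * (det (replace_row E i c) * E $ i $ j) * z $ j)"
      by (rule sum.swap)
    also have "\<dots> = (\<Sum>j\<in>UNIV. - s * (det E * c $ j) * z $ j)"
      by (simp only: sum_det_replace_row[OF assms] flip: sum_distrib_left sum_distrib_right)
    also have "\<dots> = s * det E * (\<Sum>j\<in>UNIV. - (c $ j * z $ j))"
      unfolding sum_distrib_left by (rule sum.cong) (auto simp: mult_ac)
    finally show ?thesis by simp
  qed
  then show ?thesis
    unfolding lattice_of_eq_range real_mat_vector_mult cong_lattice_def by blast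
qed

lemma finite_bezout_int:
  fixes a :: "'b \<Rightarrow> int"
  assumes "finite S"
  shows "\<exists>u. (\<Sum>i\<in>S. a i * u i) = Gcd (a ` S)"
  using assms
proof (induction S rule: finite_induct)
  case (insert x S)
  then obtain u where u: "(\<Sum>i\<in>S. a i * u i) = Gcd (a ` S)" by blast
  obtain p q where pq: "p * a x + q * Gcd (a ` S) = gcd (a x) (Gcd (a ` S))"
    using bezout_int by blast
  define v where "v = (\<lambda>i. if i = x then p else q * u i)"
  have "(\<Sum>i\<in>S. a i * v i) = (\<Sum>i\<in>S. q * (a i * u i))"
    using insert(2) by (intro sum.cong) (auto simp: v_def)
  then have "(\<Sum>i\<in>insert x S. a i * v i) = Gcd (a ` insert x S)"
    using insert(1,2) pq by (simp add: v_def u mult.commute flip: sum_distrib_left)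
  then show ?case by blast
qed auto

text \<open>Stated with sequences because the order and closeness conditions imposed later are open
  in the ratios, so all of them hold together for a large index.\<close>

lemma approximating_tuples:
  fixes \<alpha> :: "'n::finite \<Rightarrow> real" and B0 :: "real ^ 'n ^ 'n"
  assumes B0: "\<bar>det B0\<bar> = 1" and \<sigma>: "0 < \<sigma>"
    and cov: "weighted_covers (\<lambda>_. 1) \<sigma> (lattice_of B0)" and \<alpha>: "\<And>i. 0 < \<alpha> i"
  shows "\<exists>(w :: nat \<Rightarrow> 'n \<Rightarrow> int) (d :: nat \<Rightarrow> int).
    (\<forall>i. (\<lambda>m. of_int (w m i) / of_int (d m)) \<longlonglongrightarrow> \<alpha> i)
    \<and> (\<forall>\<^sub>F m in sequentially. 0 < d m)
    \<and> (\<forall>m p. prime p \<longrightarrow> p dvd d m \<longrightarrow> (\<exists>i. \<not> p dvd w m i))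
    \<and> (\<forall>r>\<sigma>. \<forall>\<^sub>F m in sequentially. weighted_covers (\<lambda>i. of_int (w m i))
      (r * of_int (d m * (\<Prod>i\<in>UNIV. w m i)) powr (1 / CARD('n))) (cong_lattice (w m) (d m)))"
proof -
  \<comment> \<open>With the extra row \<open>x v* A\<close>, Cramer's rule gives the minors
    \<open>- \<alpha> i * det A\<close>. Dividing the rows by \<open>\<alpha> i\<close> is undone by
    the ratios \<open>w m i / d m\<close>, which tend to \<open>\<alpha> i\<close>.\<close>
  define A :: "real ^ 'n ^ 'n" where "A = (\<chi> i j. 1 / \<alpha> i * B0 $ i $ j)"
  define x :: "real ^ 'n" where "x = (\<chi> i. - \<alpha> i)"
  define sg :: int where "sg = (if 0 < det B0 then 1 else - 1)"
  have sg: "of_int sg * det B0 = 1" using B0 by (auto simp: sg_def)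
  have sg': "sg \<noteq> 0" "\<bar>sg\<bar> = 1" by (auto simp: sg_def)
  define P where "P = (\<Prod>i\<in>UNIV. \<alpha> i)"
  have P: "0 < P" unfolding P_def using \<alpha> by (intro prod_pos) auto
  have detA: "det A = det B0 / P"
    unfolding A_def det_scale_rows by (simp add: P_def prod_dividef)
  define n where "n = CARD('n)"
  have n: "0 < n" by (simp add: n_def)
  have "\<exists>E c \<tau>. 0 < \<tau> \<and> (\<forall>i j. \<bar>of_int (E $ i $ j) / \<tau> - A $ i $ j\<bar> \<le> 2 / real (Suc m)) \<and>
      (\<forall>j. \<bar>of_int (c $ j) / \<tau> - (x v* A) $ j\<bar> \<le> 2 / real (Suc m)) \<and>
      (\<forall>p. prime p \<longrightarrow> p dvd det E \<longrightarrow> (\<exists>i. \<not> p dvd det (replace_row E i c)))" for m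
    by (rule primitive_approximation[of "real (Suc m)" A "x v* A"]) (simp, blast)
  then obtain E :: "nat \<Rightarrow> int ^ 'n ^ 'n" and c \<tau> where \<tau>: "\<And>m. 0 < \<tau> m"
    and E: "\<And>m i j. \<bar>of_int (E m $ i $ j) / \<tau> m - A $ i $ j\<bar> \<le> 2 / real (Suc m)"
    and c: "\<And>m j. \<bar>of_int (c m $ j) / \<tau> m - (x v* A) $ j\<bar> \<le> 2 / real (Suc m)"
    and prim: "\<And>m p. prime p \<Longrightarrow> p dvd det (E m) \<Longrightarrow> \<exists>i. \<not> p dvd det (replace_row (E m) i (c m))"
    by metis
  define w where "w m i = - sg * det (replace_row (E m) i (c m))" for m i
  define d where "d m = sg * det (E m)" for m
  define X :: "nat \<Rightarrow> real ^ 'n ^ 'n" where "X m = (\<chi> i j. of_int (E m $ i $ j) / \<tau> m)" for m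
  define Y :: "nat \<Rightarrow> real ^ 'n" where "Y m = (\<chi> j. of_int (c m $ j) / \<tau> m)" for m
  have lim: "f \<longlonglongrightarrow> l" if "\<And>m. \<bar>f m - l\<bar> \<le> 2 / real (Suc m)" for f :: "nat \<Rightarrow> real" and l
  proof -
    have "(\<lambda>m. 2 * (1 / real (Suc m))) \<longlonglongrightarrow> 2 * 0"
      by (intro tendsto_mult tendsto_const lim_1_over_n[THEN LIMSEQ_Suc])
    then have "(\<lambda>m. 2 / real (Suc m)) \<longlonglongrightarrow> 0" by simp
    then have "(\<lambda>m. f m - l) \<longlonglongrightarrow> 0"
      by (rule Lim_null_comparison[rotated]) (use that in simp)
    then show ?thesis by (simp add: LIM_zero_iff)
  qed
  have XA: "(\<lambda>m. X m $ i $ j) \<longlonglongrightarrow> A $ i $ j" for i j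
    using E by (intro lim) (simp add: X_def)
  have YA: "(\<lambda>m. Y m $ j) \<longlonglongrightarrow> (x v* A) $ j" for j
    using c by (intro lim) (simp add: Y_def)
  have scale: "det (real_mat M) = \<tau> m ^ n * det ((\<chi> i j. of_int (M $ i $ j) / \<tau> m) :: real ^ 'n ^ 'n)"
    for m and M :: "int ^ 'n ^ 'n"
    using det_scale_rows[of "\<lambda>_. 1 / \<tau> m" "real_mat M"] \<tau>[of m]
    by (simp add: real_mat_def n_def power_one_over field_simps)
  have d_eq: "of_int (d m) = \<tau> m ^ n * (sg * det (X m))" for m
    using scale[of "E m" m] by (simp add: d_def X_def det_real_mat)
  have "replace_row (X m) i (Y m) = (\<chi> k j. of_int (replace_row (E m) i (c m) $ k $ j) / \<tau> m)" for m i
    by (simp add: X_def Y_def replace_row_def vec_eq_iff)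
  then have w_eq: "of_int (w m i) = \<tau> m ^ n * (- sg * det (replace_row (X m) i (Y m)))" for m i
    using scale[of "replace_row (E m) i (c m)" m] by (simp add: w_def det_real_mat)
  have detX: "(\<lambda>m. det (X m)) \<longlonglongrightarrow> det A" by (intro tendsto_det XA)
  have "(\<lambda>m. det (replace_row (X m) i (Y m))) \<longlonglongrightarrow> det (replace_row A i (x v* A))" for i
    by (intro tendsto_det) (use XA YA in \<open>simp add: replace_row_def\<close>)
  then have detY: "(\<lambda>m. det (replace_row (X m) i (Y m))) \<longlonglongrightarrow> - \<alpha> i * det A" for i
    unfolding det_replace_row_combination by (simp add: x_def)
  have A0: "det A \<noteq> 0" using B0 P by (auto simp: detA)
  have ratio: "(\<lambda>m. of_int (w m i) / of_int (d m)) \<longlonglongrightarrow> \<alpha> i" for i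
  proof -
    have "of_int (w m i) / of_int (d m) = - (det (replace_row (X m) i (Y m)) / det (X m))" for m
      using \<tau>[of m] sg' by (simp add: w_eq d_eq)
    moreover have "(\<lambda>m. - (det (replace_row (X m) i (Y m)) / det (X m))) \<longlonglongrightarrow> - (- \<alpha> i * det A / det A)"
      by (intro tendsto_intros detX detY A0)
    ultimately show ?thesis using A0 by simp
  qed
  have d_lim: "(\<lambda>m. of_int (d m) / \<tau> m ^ n) \<longlonglongrightarrow> 1 / P"
  proof -
    have "of_int (d m) / \<tau> m ^ n = sg * det (X m)" for m using \<tau>[of m] by (simp add: d_eq)
    moreover have "(\<lambda>m. sg * det (X m)) \<longlonglongrightarrow> sg * det A" by (intro tendsto_intros detX)
    moreover have "sg * det A = 1 / P" using sg by (simp add: detA)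
    ultimately show ?thesis by simp
  qed
  have dpos: "\<forall>\<^sub>F m in sequentially. 0 < d m"
  proof -
    have "\<forall>\<^sub>F m in sequentially. 0 < of_int (d m) / \<tau> m ^ n"
      using order_tendstoD(1)[OF d_lim] P by simp
    then show ?thesis
    proof eventually_elim
      case (elim m)
      then show ?case using \<tau>[of m] by (simp add: zero_less_divide_iff)
    qed
  qed
  have wpos: "\<forall>\<^sub>F m in sequentially. \<forall>i. 0 < of_int (w m i) / real_of_int (d m)"
    by (intro eventually_all_finite) (use order_tendstoD(1)[OF ratio \<alpha>] in blast)
  \<comment> \<open>Since \<open>d m\<close> times the product of the \<open>w m i\<close> equals
    \<open>(d m * \<tau> m) ^ n * q m\<close>, the limit 1 of \<open>q\<close> says that the
    normalising root is asymptotically \<open>d m * \<tau> m\<close>.\<close>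
  define q where "q m = of_int (d m) / \<tau> m ^ n * (\<Prod>i\<in>UNIV. of_int (w m i) / of_int (d m))" for m
  have "q \<longlonglongrightarrow> 1 / P * (\<Prod>i\<in>UNIV. \<alpha> i)"
    unfolding q_def by (intro tendsto_intros d_lim ratio)
  then have "q \<longlonglongrightarrow> 1" using P by (simp flip: P_def)
  then have qlim: "(\<lambda>m. q m powr (1 / n)) \<longlonglongrightarrow> 1 powr (1 / n)"
    by (intro tendsto_intros) auto
  have covers: "\<forall>\<^sub>F m in sequentially. weighted_covers (\<lambda>i. of_int (w m i))
      (r * of_int (d m * (\<Prod>i\<in>UNIV. w m i)) powr (1 / n)) (cong_lattice (w m) (d m))"
    if r: "\<sigma> < r" for r
  proof -
    \<comment> \<open>Half of the gap between \<open>\<sigma>\<close> and \<open>r\<close> pays for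
      the perturbation, the other half for replacing the root of \<open>q m\<close> by its
      limit.\<close>
    define \<delta> where "\<delta> = (r - \<sigma>) / 2"
    have \<delta>: "0 < \<delta>" "\<sigma> + \<delta> < r" using r by (auto simp: \<delta>_def field_simps)
    define X' :: "nat \<Rightarrow> real ^ 'n ^ 'n"
      where "X' m = (\<chi> i j. of_int (w m i) / of_int (d m) * X m $ i $ j)" for m
    have "(\<lambda>m. X' m $ i $ j) \<longlonglongrightarrow> B0 $ i $ j" for i j
    proof -
      have "(\<lambda>m. of_int (w m i) / of_int (d m) * X m $ i $ j) \<longlonglongrightarrow> \<alpha> i * A $ i $ j"
        by (intro tendsto_mult ratio XA)
      then show ?thesis using \<alpha>[of i] by (simp add: X'_def A_def)
    qed
    then have "\<forall>\<^sub>F m in sequentially. weighted_covers (\<lambda>_. 1) (\<sigma> + \<delta>) (lattice_of (X' m))"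
      using B0 by (intro weighted_covers_perturb[OF _ \<sigma> cov _ \<delta>(1)]) (auto simp: invertible_det_nz)
    moreover have "\<forall>\<^sub>F m in sequentially. \<sigma> + \<delta> < r * q m powr (1 / n)"
      using order_tendstoD(1)[of "\<lambda>m. r * q m powr (1 / n)" r sequentially "\<sigma> + \<delta>"]
        tendsto_mult[OF tendsto_const[of r] qlim] \<delta>(2) by simp
    ultimately show ?thesis using dpos wpos
    proof eventually_elim
      case (elim m)
      have w0: "0 < w m i" for i using elim(3,4) by (simp add: zero_less_divide_iff)
      let ?v = "\<lambda>i. real_of_int (w m i)"
      let ?r = "of_int (d m) * \<tau> m"
      have r0: "0 < ?r" using elim(3) \<tau>[of m] by simp
      \<comment> \<open>Passing from unit weights to \<open>w m\<close> at scale
        \<open>d m * \<tau> m\<close> turns \<open>X' m\<close> exactly into the integer matrix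
        \<open>E m\<close>.\<close>
      have "weighted_covers ?v (?r * (\<sigma> + \<delta>)) (lattice_of (\<chi> i j. ?r * 1 / ?v i * X' m $ i $ j))"
        by (rule weighted_covers_scale[OF elim(1) r0]) (use w0 in auto)
      moreover have "(\<chi> i j. ?r * 1 / ?v i * X' m $ i $ j) = real_mat (E m)"
        using elim(3) \<tau>[of m] w0 by (simp add: X'_def X_def real_mat_def vec_eq_iff less_imp_neq[symmetric])
      ultimately have cov1: "weighted_covers ?v (?r * (\<sigma> + \<delta>)) (lattice_of (real_mat (E m)))" by simp
      have "det (E m) \<noteq> 0" using elim(3) by (auto simp: d_def)
      then have "lattice_of (real_mat (E m)) \<subseteq> cong_lattice (w m) (d m)"
        unfolding w_def[abs_def] d_def by (rule lattice_subset_cong_lattice)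
      from weighted_covers_mono[OF cov1 this]
      have cov2: "weighted_covers ?v (?r * (\<sigma> + \<delta>)) (cong_lattice (w m) (d m))" .
      have "real_of_int (d m * (\<Prod>i\<in>UNIV. w m i)) = ?r ^ n * q m"
        using elim(3) \<tau>[of m]
        by (simp add: q_def prod_dividef n_def power_mult_distrib)
      moreover have "0 \<le> q m" unfolding q_def using elim(3,4) \<tau>[of m]
        by (intro mult_nonneg_nonneg prod_nonneg) (auto intro: less_imp_le)
      moreover have "(?r ^ n) powr (1 / n) = ?r"
        using r0 n by (simp add: powr_powr flip: powr_realpow)
      ultimately have "of_int (d m * (\<Prod>i\<in>UNIV. w m i)) powr (1 / n) = ?r * q m powr (1 / n)"
        using r0 by (simp add: powr_mult)
      then have "?r * (\<sigma> + \<delta>) \<le> r * of_int (d m * (\<Prod>i\<in>UNIV. w m i)) powr (1 / n)"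
        using mult_left_mono[OF less_imp_le[OF elim(2)], of ?r] r0 by (simp add: mult_ac)
      with cov2 show ?case unfolding weighted_covers_def by (meson order_trans)
    qed
  qed
  have "\<exists>i. \<not> p dvd w m i" if "prime p" "p dvd d m" for m p
  proof -
    have unit: "p dvd sg * y \<longleftrightarrow> p dvd y" for y by (simp add: sg_def)
    from that have "p dvd det (E m)" by (simp add: d_def unit)
    from prim[OF that(1) this] show ?thesis by (simp add: w_def unit)
  qed
  with ratio dpos covers show ?thesis
    unfolding n_def by (intro exI[of _ w] exI[of _ d] conjI allI impI)
qed

section \<open>Frobenius tuples\<close>

lemma
  fixes h :: "'n::finite \<Rightarrow> nat"
  assumes h: "bij_betw h UNIV {1..N-1}" and N: "1 \<le> N"
  shows sum_split_last: "(\<Sum>i=1..N. g i :: 'a::comm_ring_1) = (\<Sum>i\<in>UNIV. g (h i)) + g N"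
    and prod_split_last: "(\<Prod>i=1..N. g i) = g N * (\<Prod>i\<in>UNIV. g (h i))"
proof -
  have "{1..N} = insert N {1..N-1}" "N \<notin> {1..N-1}" using N by auto
  then show "(\<Sum>i=1..N. g i) = (\<Sum>i\<in>UNIV. g (h i)) + g N" "(\<Prod>i=1..N. g i) = g N * (\<Prod>i\<in>UNIV. g (h i))"
    using sum.reindex_bij_betw[OF h, of g] prod.reindex_bij_betw[OF h, of g] by (simp_all add: add.commute)
qed

lemma f_pos_eq_Greatest_pos_rep:
  fixes h :: "'n::finite \<Rightarrow> nat"
  assumes h: "bij_betw h UNIV {1..N-1}" and N: "1 \<le> N"
  shows "f_pos N a = (GREATEST m. \<not> pos_rep (\<lambda>i. a (h i)) (a N) m)"
proof -
  have hN: "h i \<in> {1..N-1}" for i using h by (auto simp: bij_betw_def)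
  have "(\<exists>x :: nat \<Rightarrow> int. (\<forall>i\<in>{1..N}. 1 \<le> x i) \<and> m = (\<Sum>i=1..N. x i * a i))
      \<longleftrightarrow> pos_rep (\<lambda>i. a (h i)) (a N) m" for m
  proof
    assume "\<exists>x :: nat \<Rightarrow> int. (\<forall>i\<in>{1..N}. 1 \<le> x i) \<and> m = (\<Sum>i=1..N. x i * a i)"
    then obtain x :: "nat \<Rightarrow> int" where x: "\<forall>i\<in>{1..N}. 1 \<le> x i" "m = (\<Sum>i=1..N. x i * a i)" by blast
    have "h i \<in> {1..N}" for i using hN[of i] by auto
    with x N show "pos_rep (\<lambda>i. a (h i)) (a N) m"
      unfolding pos_rep_def sum_split_last[OF h N]
      by (intro exI[of _ "\<lambda>i. x (h i)"] exI[of _ "x N"]) (auto simp: mult.commute)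
  next
    assume "pos_rep (\<lambda>i. a (h i)) (a N) m"
    then obtain x y where x: "\<And>i. 1 \<le> x i" "1 \<le> y" "m = (\<Sum>i\<in>UNIV. a (h i) * x i) + a N * y"
      unfolding pos_rep_def by blast
    define x' where "x' k = (if k = N then y else x (inv h k))" for k
    have "x' (h i) = x i" for i
      using hN[of i] h N by (auto simp: x'_def bij_betw_def)
    then have "m = (\<Sum>i=1..N. x' i * a i)"
      unfolding sum_split_last[OF h N] using x(3) by (simp add: x'_def mult.commute)
    moreover have "\<forall>i\<in>{1..N}. 1 \<le> x' i" using x by (simp add: x'_def)
    ultimately show "\<exists>x :: nat \<Rightarrow> int. (\<forall>i\<in>{1..N}. 1 \<le> x i) \<and> m = (\<Sum>i=1..N. x i * a i)" by blast
  qed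
  then show ?thesis unfolding f_pos_def by simp
qed

lemma admissible_pos:
  assumes "admissible N a" and "i \<in> {1..N}"
  shows "0 < a i"
proof (cases "i = 1")
  case False
  then have "a 1 < a i"
    using assms unfolding admissible_def by (auto intro: strict_mono_onD)
  then show ?thesis using assms unfolding admissible_def by linarith
qed (use assms in \<open>auto simp: admissible_def\<close>)

lemma admissible_bezout:
  fixes h :: "'n::finite \<Rightarrow> nat"
  assumes "admissible N a" and h: "bij_betw h UNIV {1..N-1}" and N: "1 \<le> N"
  obtains u k where "(\<Sum>i\<in>UNIV. a (h i) * u i) + a N * k = 1"
proof -
  obtain u where "(\<Sum>i=1..N. a i * u i) = Gcd (a ` {1..N})"
    using finite_bezout_int[of "{1..N}" a] by auto
  then have "(\<Sum>i\<in>UNIV. a (h i) * u (h i)) + a N * u N = 1"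
    using assms(1) unfolding sum_split_last[OF h N] admissible_def by simp
  then show thesis using that[of "\<lambda>i. u (h i)" "u N"] by simp
qed

lemma abs_inhom_min_simplex_le_f_pos_quotient:
  fixes N :: nat
  assumes N: "2 \<le> N" and card: "CARD('n::finite) = N - 1" and a: "admissible N a"
  shows "abs_inhom_min (std_simplex :: (real ^ 'n) set)
    \<le> real_of_int (f_pos N a) / real_of_int (\<Prod>i=1..N. a i) powr (1 / (real N - 1))"
proof -
  obtain h :: "'n \<Rightarrow> nat" where h: "bij_betw h UNIV {1..N-1}"
    using finite_same_card_bij[of "UNIV :: 'n set" "{1..N-1}"] card by auto
  have N1: "1 \<le> N" using N by simp
  have n: "real N - 1 = CARD('n)" using card N by simp
  have h_mem: "h i \<in> {1..N}" for i
    using bij_betwE[OF h, rule_format, of i] by auto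
  define w where "w i = a (h i)" for i
  define d where "d = a N"
  have w: "0 < w i" for i unfolding w_def by (rule admissible_pos[OF a h_mem])
  have d: "0 < d" unfolding d_def by (rule admissible_pos[OF a]) (use N in auto)
  obtain u k where bez: "(\<Sum>i\<in>UNIV. w i * u i) + d * k = 1"
    using admissible_bezout[OF a h N1] unfolding w_def d_def .
  define F where "F = f_pos N a"
  have "F = (GREATEST m. \<not> pos_rep w d m)"
    unfolding F_def w_def d_def by (rule f_pos_eq_Greatest_pos_rep[OF h N1])
  then have rep: "pos_rep w d m" if "F < m" for m
    using Greatest_not_pos_rep(2)[OF w d bez] that by simp
  \<comment> \<open>A dilation factor must be positive; here this holds because 1 is not a sum of
    two positive integers.\<close>
  have "0 < F"
  proof (rule ccontr)
    assume "\<not> 0 < F"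
    then obtain x y where x: "\<And>i. 1 \<le> x i" "1 \<le> y" "1 = (\<Sum>i\<in>UNIV. w i * x i) + d * y"
      using rep[of 1] unfolding pos_rep_def by auto
    have "0 < d * y" using d x(2) by simp
    moreover have "0 < w i * x i" for i using w[of i] x(1)[of i] by simp
    then have "0 < (\<Sum>i\<in>UNIV. w i * x i)" by (intro sum_pos) auto
    ultimately show False using x(3) by linarith
  qed
  obtain B where B: "invertible B" "lattice_of B = cong_lattice w d" "real_of_int d \<le> \<bar>det B\<bar>"
    using cong_lattice_basis[OF d bez] .
  define \<Pi>w where "\<Pi>w = (\<Prod>i\<in>UNIV. real_of_int (w i))"
  have \<Pi>w: "0 < \<Pi>w" unfolding \<Pi>w_def using w by (intro prod_pos) auto
  have B0: "0 < \<bar>det B\<bar>" using B(3) d by linarith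
  \<comment> \<open>Chosen so that the rows of \<open>B\<close> multiplied by
    \<open>w i / \<rho>\<close> form a matrix of determinant 1 or -1.\<close>
  define \<rho> where "\<rho> = (\<bar>det B\<bar> * \<Pi>w) powr (1 / CARD('n))"
  have \<rho>: "0 < \<rho>" using B0 \<Pi>w by (simp add: \<rho>_def)
  have \<rho>n: "\<rho> ^ CARD('n) = \<bar>det B\<bar> * \<Pi>w"
    using B0 \<Pi>w \<rho> by (simp add: \<rho>_def powr_powr flip: powr_realpow)
  have "weighted_covers (\<lambda>i. real_of_int (w i)) F (lattice_of B)"
    unfolding B(2) by (rule covers_if_pos_rep[OF w d rep])
  from weighted_covers_scale[OF this, of "1 / \<rho>" "\<lambda>_. 1"]
  have "weighted_covers (\<lambda>_. 1) (F / \<rho>) (lattice_of (\<chi> i j. w i / \<rho> * B $ i $ j))"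
    using w \<rho> by simp
  moreover have "\<bar>det (\<chi> i j. w i / \<rho> * B $ i $ j)\<bar> = 1"
    unfolding det_scale_rows using \<Pi>w B0 by (simp add: prod_dividef \<rho>n abs_mult flip: \<Pi>w_def)
  moreover have "0 < F / \<rho>" using \<open>0 < F\<close> \<rho> by simp
  ultimately have "abs_inhom_min (std_simplex :: (real ^ 'n) set) \<le> F / \<rho>"
    by (intro abs_inhom_min_simplex_le)
  also have prod: "real_of_int (\<Prod>i=1..N. a i) = d * \<Pi>w"
    unfolding prod_split_last[OF h N1] by (simp add: \<Pi>w_def w_def d_def)
  \<comment> \<open>Replacing the absolute value of \<open>det B\<close> by the smaller
    \<open>d\<close> can only enlarge the quotient.\<close>
  have "F / \<rho> \<le> F / (d * \<Pi>w) powr (1 / CARD('n))"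
    using \<open>0 < F\<close> \<rho> d \<Pi>w B(3) unfolding \<rho>_def
    by (intro divide_left_mono powr_mono2 mult_right_mono mult_pos_pos) auto
  finally show ?thesis unfolding F_def prod n .
qed

lemma f_pos_quotient_approximates_abs_inhom_min:
  fixes N :: nat and \<alpha> :: "nat \<Rightarrow> real"
  assumes N: "2 \<le> N" and card: "CARD('n::finite) = N - 1" and \<epsilon>: "0 < \<epsilon>" and \<alpha>: "ratio_point N \<alpha>"
  shows "\<exists>a. admissible N a
    \<and> (\<forall>i\<in>{1..N-1}. \<bar>\<alpha> i - real_of_int (a i) / real_of_int (a N)\<bar> < \<epsilon>)
    \<and> real_of_int (f_pos N a) / real_of_int (\<Prod>i=1..N. a i) powr (1 / (real N - 1))
        < abs_inhom_min (std_simplex :: (real ^ 'n) set) + \<epsilon>"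
proof -
  obtain h :: "'n \<Rightarrow> nat" where h: "bij_betw h UNIV {1..N-1}"
    using finite_same_card_bij[of "UNIV :: 'n set" "{1..N-1}"] card by auto
  have N1: "1 \<le> N" using N by simp
  have n: "real N - 1 = CARD('n)" using card N by simp
  have h_mem: "h i \<in> {1..N-1}" for i using h by (auto simp: bij_betw_def)
  have h_inv: "inv h (h i) = i" for i using h by (simp add: bij_betw_def)
  have inv_h: "h (inv h k) = k" if "k \<in> {1..N-1}" for k
    using h that by (auto simp: bij_betw_def f_inv_into_f)
  define \<eta> where "\<eta> = min (1 / 2) (\<epsilon> / 2)"
  have \<eta>: "0 < \<eta>" "\<eta> < 1" "\<eta> < \<epsilon>" using \<epsilon> by (auto simp: \<eta>_def)
  \<comment> \<open>Mixing in the equally spaced points \<open>k / N\<close> makes the target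
    strictly increasing and interior to \<open>(0,1)\<close>, while moving it by at most
    \<open>\<eta>\<close>.\<close>
  define \<beta> where "\<beta> k = (1 - \<eta>) * \<alpha> k + \<eta> * (real k / real N)" for k
  have \<alpha>01: "0 \<le> \<alpha> k" "\<alpha> k \<le> 1" if "k \<in> {1..N-1}" for k
    using \<alpha> that unfolding ratio_point_def by auto
  have kN: "0 < real k / real N" "real k / real N < 1" if "k \<in> {1..N-1}" for k
    using that by auto
  have \<beta>_pos: "0 < \<beta> k" if "k \<in> {1..N-1}" for k
    using \<alpha>01[OF that] kN[OF that] \<eta> unfolding \<beta>_def
    by (intro add_nonneg_pos mult_nonneg_nonneg mult_pos_pos) linarith+
  have \<beta>_less1: "\<beta> k < 1" if "k \<in> {1..N-1}" for k
  proof -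
    have "(1 - \<eta>) * \<alpha> k \<le> (1 - \<eta>) * 1" using \<alpha>01[OF that] \<eta> by (intro mult_left_mono) auto
    moreover have "\<eta> * (real k / real N) < \<eta> * 1" using kN[OF that] \<eta> by (intro mult_strict_left_mono) auto
    ultimately have "\<beta> k < (1 - \<eta>) * 1 + \<eta> * 1" unfolding \<beta>_def by (rule add_le_less_mono)
    then show ?thesis by simp
  qed
  have \<beta>_mono: "\<beta> k < \<beta> l" if "k \<in> {1..N-1}" "l \<in> {1..N-1}" "k < l" for k l
  proof -
    have "\<alpha> k \<le> \<alpha> l" using \<alpha> that unfolding ratio_point_def by (auto intro: mono_onD)
    then have "(1 - \<eta>) * \<alpha> k \<le> (1 - \<eta>) * \<alpha> l" using \<eta> by (intro mult_left_mono) auto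
    moreover have "\<eta> * (real k / real N) < \<eta> * (real l / real N)"
      using \<eta> that N by (intro mult_strict_left_mono divide_strict_right_mono) auto
    ultimately show ?thesis unfolding \<beta>_def by (rule add_le_less_mono)
  qed
  have \<beta>_close: "\<bar>\<alpha> k - \<beta> k\<bar> < \<epsilon>" if "k \<in> {1..N-1}" for k
  proof -
    have "\<alpha> k - \<beta> k = \<eta> * (\<alpha> k - real k / real N)" by (simp add: \<beta>_def algebra_simps)
    moreover have "\<bar>\<alpha> k - real k / real N\<bar> \<le> 1" using \<alpha>01[OF that] kN[OF that] by linarith
    then have "\<eta> * \<bar>\<alpha> k - real k / real N\<bar> \<le> \<eta>" using \<eta> by (simp add: mult_left_le)
    then have "\<bar>\<eta> * (\<alpha> k - real k / real N)\<bar> < \<epsilon>"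
      unfolding abs_mult using \<eta> by (simp only: abs_of_pos order.strict_trans1)
    ultimately show ?thesis by (simp only:)
  qed
  define \<mu> where "\<mu> = abs_inhom_min (std_simplex :: (real ^ 'n) set)"
  \<comment> \<open>The bound \<open>\<mu> + \<epsilon> / 2\<close> leaves room above
    \<open>\<sigma>\<close> for the approximation and room below \<open>\<mu> + \<epsilon>\<close>
    for the strict inequality.\<close>
  obtain B0 :: "real ^ 'n ^ 'n" and \<sigma> where B0: "\<bar>det B0\<bar> = 1" "0 < \<sigma>" "\<sigma> < \<mu> + \<epsilon> / 2"
    "weighted_covers (\<lambda>_. 1) \<sigma> (lattice_of B0)"
    using abs_inhom_min_simplex_approx[of "\<mu> + \<epsilon> / 2", where 'n = 'n] \<epsilon> unfolding \<mu>_def by auto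
  have "0 < \<beta> (h i)" for i by (rule \<beta>_pos[OF h_mem])
  from approximating_tuples[where \<alpha> = "\<lambda>i. \<beta> (h i)", OF B0(1,2,4) this]
  obtain w d where tuples: "\<forall>i. (\<lambda>m. of_int (w m i) / of_int (d m)) \<longlonglongrightarrow> \<beta> (h i)"
      "\<forall>m p. prime p \<longrightarrow> p dvd d m \<longrightarrow> (\<exists>i. \<not> p dvd w m i)"
      "\<forall>r>\<sigma>. \<forall>\<^sub>F m in sequentially. weighted_covers (\<lambda>i. of_int (w m i))
        (r * of_int (d m * (\<Prod>i\<in>UNIV. w m i)) powr (1 / CARD('n))) (cong_lattice (w m) (d m))"
    and d: "\<forall>\<^sub>F m in sequentially. 0 < d m"
    by (elim exE conjE)
  note ratio = tuples(1)[rule_format] and prim = tuples(2)[rule_format] and cov = tuples(3)[rule_format]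
  have "\<forall>\<^sub>F m in sequentially. \<bar>\<alpha> (h i) - of_int (w m i) / of_int (d m)\<bar> < \<epsilon>" for i
  proof -
    have "(\<lambda>m. \<bar>\<alpha> (h i) - of_int (w m i) / of_int (d m)\<bar>) \<longlonglongrightarrow> \<bar>\<alpha> (h i) - \<beta> (h i)\<bar>"
      by (intro tendsto_intros ratio)
    from order_tendstoD(2)[OF this \<beta>_close[OF h_mem]] show ?thesis .
  qed
  then have ev_close: "\<forall>\<^sub>F m in sequentially. \<forall>i. \<bar>\<alpha> (h i) - of_int (w m i) / of_int (d m)\<bar> < \<epsilon>"
    by (rule eventually_all_finite)
  have ev_pos: "\<forall>\<^sub>F m in sequentially. \<forall>i. 0 < of_int (w m i) / real_of_int (d m)"
    by (intro eventually_all_finite) (use order_tendstoD(1)[OF ratio \<beta>_pos[OF h_mem]] in blast)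
  have ev_less1: "\<forall>\<^sub>F m in sequentially. \<forall>i. of_int (w m i) / real_of_int (d m) < 1"
    by (intro eventually_all_finite) (use order_tendstoD(2)[OF ratio \<beta>_less1[OF h_mem]] in blast)
  have "\<forall>\<^sub>F m in sequentially. h i < h j \<longrightarrow> of_int (w m i) / real_of_int (d m) < of_int (w m j) / real_of_int (d m)" for i j
  proof (cases "h i < h j")
    case True
    have "(\<lambda>m. of_int (w m j) / real_of_int (d m) - of_int (w m i) / real_of_int (d m)) \<longlonglongrightarrow> \<beta> (h j) - \<beta> (h i)"
      by (intro tendsto_intros ratio)
    from order_tendstoD(1)[OF this, of 0] \<beta>_mono[OF h_mem h_mem True] show ?thesis
      by (simp add: True)
  qed simp
  then have ev_mono: "\<forall>\<^sub>F m in sequentially. \<forall>i j. h i < h j \<longrightarrow>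
      of_int (w m i) / real_of_int (d m) < of_int (w m j) / real_of_int (d m)"
    by (intro eventually_all_finite)
  have "\<forall>\<^sub>F m in sequentially. 0 < d m \<and> (\<forall>i. \<bar>\<alpha> (h i) - of_int (w m i) / of_int (d m)\<bar> < \<epsilon>) \<and>
      (\<forall>i. 0 < of_int (w m i) / real_of_int (d m)) \<and> (\<forall>i. of_int (w m i) / real_of_int (d m) < 1) \<and>
      (\<forall>i j. h i < h j \<longrightarrow> of_int (w m i) / real_of_int (d m) < of_int (w m j) / real_of_int (d m)) \<and>
      weighted_covers (\<lambda>i. of_int (w m i))
        ((\<mu> + \<epsilon> / 2) * of_int (d m * (\<Prod>i\<in>UNIV. w m i)) powr (1 / CARD('n))) (cong_lattice (w m) (d m))"
    by (intro eventually_conj d ev_close ev_pos ev_less1 ev_mono cov B0)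
  then obtain m where m: "0 < d m" "\<And>i. \<bar>\<alpha> (h i) - of_int (w m i) / of_int (d m)\<bar> < \<epsilon>"
      "\<And>i. 0 < of_int (w m i) / real_of_int (d m)" "\<And>i. of_int (w m i) / real_of_int (d m) < 1"
      "\<And>i j. h i < h j \<Longrightarrow> of_int (w m i) / real_of_int (d m) < of_int (w m j) / real_of_int (d m)"
      "weighted_covers (\<lambda>i. of_int (w m i))
        ((\<mu> + \<epsilon> / 2) * of_int (d m * (\<Prod>i\<in>UNIV. w m i)) powr (1 / CARD('n))) (cong_lattice (w m) (d m))"
    using eventually_happens'[OF sequentially_bot] by blast
  have w: "0 < w m i" "w m i < d m" for i
    using m(1) m(3,4)[of i] by (auto simp: zero_less_divide_iff divide_less_eq)
  have w_mono: "w m i < w m j" if "h i < h j" for i j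
    using m(5)[OF that] m(1) by (simp add: divide_less_cancel)
  define a where "a k = (if k = N then d m else w m (inv h k))" for k
  have aN: "a N = d m" by (simp add: a_def)
  have ah: "a (h i) = w m i" for i using h_mem[of i] N by (auto simp: a_def h_inv)
  have a_cases: "k = N \<or> (\<exists>i. k = h i)" if "k \<in> {1..N}" for k
    using that inv_h[of k] by (cases "k = N") (auto intro: exI[of _ "inv h k"])
  have "strict_mono_on {1..N} a"
  proof (rule strict_mono_onI)
    fix k l assume kl: "k \<in> {1..N}" "l \<in> {1..N}" "k < l"
    then obtain i where i: "k = h i" using a_cases[of k] by auto
    show "a k < a l"
      using a_cases[OF kl(2)] w w_mono kl(3) by (auto simp: i aN ah)
  qed
  moreover have "0 < a 1" using a_cases[of 1] N w m(1) aN ah by (metis atLeastAtMost_iff order_refl N1)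
  \<comment> \<open>A prime dividing all entries would divide \<open>d m\<close> and every
    \<open>w m i\<close>, against the coprimality of the minors.\<close>
  moreover have "Gcd (a ` {1..N}) = 1"
  proof (rule ccontr)
    assume g: "Gcd (a ` {1..N}) \<noteq> 1"
    have dvd: "Gcd (a ` {1..N}) dvd a k" if "k \<in> {1..N}" for k using that by (intro Gcd_dvd) auto
    have "Gcd (a ` {1..N}) dvd d m" using dvd[of N] N1 by (simp add: aN)
    then have "Gcd (a ` {1..N}) \<noteq> 0" using m(1) by (metis dvd_0_left less_irrefl)
    moreover have "\<not> is_unit (Gcd (a ` {1..N}))" using g by auto
    ultimately obtain p where p: "prime p" "p dvd Gcd (a ` {1..N})" using prime_divisor_exists by blast
    have "p dvd d m" using dvd_trans[OF p(2) dvd[of N]] N by (simp add: aN)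
    with prim[OF p(1)] obtain i where "\<not> p dvd w m i" by blast
    moreover have "h i \<in> {1..N}" using h_mem[of i] by auto
    ultimately show False using dvd_trans[OF p(2) dvd[of "h i"]] by (simp add: ah)
  qed
  ultimately have adm: "admissible N a" unfolding admissible_def by blast
  have "\<bar>\<alpha> k - real_of_int (a k) / real_of_int (a N)\<bar> < \<epsilon>" if "k \<in> {1..N-1}" for k
    using m(2)[of "inv h k"] inv_h[OF that] ah[of "inv h k"] by (simp add: aN)
  moreover have "real_of_int (f_pos N a) / real_of_int (\<Prod>i=1..N. a i) powr (1 / (real N - 1)) < \<mu> + \<epsilon>"
  proof -
    obtain u k where bez: "(\<Sum>i\<in>UNIV. w m i * u i) + d m * k = 1"
      using admissible_bezout[OF adm h N1] unfolding ah aN .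
    have "f_pos N a = (GREATEST l. \<not> pos_rep (w m) (d m) l)"
      using f_pos_eq_Greatest_pos_rep[OF h N1, of a] by (simp add: ah aN)
    then have "\<not> pos_rep (w m) (d m) (f_pos N a)"
      using Greatest_not_pos_rep(1)[OF w(1) m(1) bez] by simp
    \<comment> \<open>\<open>f_pos N a\<close> itself has no positive representation, whereas every
      integer above the covering size has one.\<close>
    then have le: "f_pos N a \<le> (\<mu> + \<epsilon> / 2) * of_int (d m * (\<Prod>i\<in>UNIV. w m i)) powr (1 / CARD('n))"
      using pos_rep_if_covers[OF w(1) m(1) bez m(6)] by (meson not_le)
    have "(\<Prod>i=1..N. a i) = d m * (\<Prod>i\<in>UNIV. w m i)"
      unfolding prod_split_last[OF h N1] by (simp add: ah aN)
    moreover have "0 < d m * (\<Prod>i\<in>UNIV. w m i)" using w m(1) by (intro mult_pos_pos prod_pos) auto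
    then have "0 < real_of_int (d m * (\<Prod>i\<in>UNIV. w m i)) powr (1 / CARD('n))"
      unfolding powr_gt_zero by (metis less_irrefl of_int_0_less_iff)
    ultimately have "real_of_int (f_pos N a) / real_of_int (\<Prod>i=1..N. a i) powr (1 / (real N - 1)) \<le> \<mu> + \<epsilon> / 2"
      using le unfolding n by (simp only: pos_divide_le_eq)
    then show ?thesis using \<epsilon> by linarith
  qed
  ultimately show ?thesis using adm unfolding \<mu>_def by blast
qed

theorem theorem1:
  fixes N :: nat
  assumes "3 \<le> N" and "CARD('n::finite) = N - 1"
  shows "(\<forall>a. admissible N a \<longrightarrow>
            abs_inhom_min (std_simplex :: (real ^ 'n) set)
              \<le> real_of_int (f_pos N a) / real_of_int (\<Prod>i=1..N. a i) powr (1 / (real N - 1)))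
       \<and> (\<forall>\<epsilon>>0. \<forall>\<alpha> :: nat \<Rightarrow> real. ratio_point N \<alpha> \<longrightarrow>
            (\<exists>a. admissible N a
               \<and> (\<forall>i\<in>{1..N-1}. \<bar>\<alpha> i - real_of_int (a i) / real_of_int (a N)\<bar> < \<epsilon>)
               \<and> real_of_int (f_pos N a) / real_of_int (\<Prod>i=1..N. a i) powr (1 / (real N - 1))
                   < abs_inhom_min (std_simplex :: (real ^ 'n) set) + \<epsilon>))"
proof -
  have "2 \<le> N" using assms(1) by simp
  then show ?thesis
    using abs_inhom_min_simplex_le_f_pos_quotient[OF _ assms(2)] f_pos_quotient_approximates_abs_inhom_min[OF _ assms(2)]
    by blast
qed

end
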